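(* Let $f(\zeta)=\zeta+\beta+o(1)$, with $\beta\in\mathbb{C}^{+}$, be a hyperbolic complex Dulac germ on a standard quadratic domain $\mathcal{R}_C$. Then there exists a unique parabolic germ $\varphi$ satisfying $$\varphi\circ f=\varphi+\beta$$ on $f$-invariant germs of $\mathcal{R}_C$. Moreover, $\varphi$ is a complex parabolic Dulac germ (possibly on a smaller standard quadratic subdomain $\mathcal{R}_{C'}\subset\mathcal{R}_C$). Furthermore, if $f$ is a real Dulac germ, then $\varphi$ is also a real Dulac germ.
   Context: $\mathbb{C}^+:=\{\zeta\in\mathbb{C}:\Re(\zeta)>0\}$. For $C>0$, the standard quadratic domain is $\mathcal{R}_C:=\kappa(\mathbb{C}^+)\subset\mathbb{C}$, where $\kappa(\zeta)=\zeta+C(\zeta+1)^{1/2}$. For $R>0$, $(\mathcal{R}_C)_R:=\mathcal{R}_C\cap([R,+\infty)\times\mathbb{R})$, i.e. the points of $\mathcal{R}_C$ with real part at least $R$; these sets are called the germs of the standard quadratic domain $\mathcal{R}_C$. A set $S$ in the domain of $f$ is $f$-invariant if $f(S)\subseteq S$; an $f$-invariant germ of $\mathcal{R}_C$ is a set $(\mathcal{R}_C)_R$ that is $f$-invariant. Every statement on germs of maps means the similar statement for some representative of these germs. A complex Dulac series is a formal series $$\widehat f=\alpha\zeta+\beta+\sum_{i=1}^{\infty}P_i(\zeta)\exp(-\alpha_i\zeta),\quad \alpha\in\mathbb{R}_{>0},\ \beta\in\mathbb{C},\ P_i\in\mathbb{C}[\zeta],$$ where $(\alpha_i)_{i\ge1}$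 is a strictly increasing sequence of positive real numbers, tending to $+\infty$, belonging to a finitely generated sub-semigroup of $(\mathbb{R}_{>0},+)$. It is parabolic if $\alpha=1$ and $\beta=0$. A complex Dulac germ is a holomorphic germ $f$ on a standard quadratic domain $\mathcal{R}_C$ which admits on $\mathcal{R}_C$ a complex Dulac series as asymptotic expansion, uniformly in the following sense: for every $\nu>0$ there is $N_\nu\in\mathbb{N}$ such that $$\Big|f(\zeta)-\alpha\zeta-\beta-\sum_{i=1}^{N_\nu}P_i(\zeta)\exp(-\alpha_i\zeta)\Big|=o(\exp(-\nu\zeta))$$ as $\Re(\zeta)\to+\infty$ in $\mathcal{R}_C$. If a complex Dulac germ $f$ additionally satisfies that the image of $\{\zeta\in\mathcal{R}_C:\Im(\zeta)=0\}$ is again a subset of $\{\zeta\in\mathcal{R}_C:\Im(\zeta)=0\}$, then $f$ is called a real Dulac germ. An analytic germ $f$ at $+\infty$ is called parabolic if $f(\zeta)=\zeta+o(1)$ as $|\zeta|\to+\infty$ and $f^{\circ q}\neq\mathrm{id}$ for all $q\in\mathbb{N}_{\ge1}$ (where $f^{\circ q}$ is the $q$-th iterate); it is called hyperbolic if $f(\zeta)=\zeta+\beta+o(1)$ as $|\zeta|\to+\infty$ for some $\beta\in\mathbb{C}^+$.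
   Formalization: For the translation f(ζ)=ζ+β the only solution ζ+o(1) is the identity, which is not parabolic as defined; so φ is claimed to be parabolic (no iterate equal to id) only when f is not this translation, while all other claims, with φ=ζ+o(1), hold for every f. *)

theory Defs
  imports "HOL-Complex_Analysis.Complex_Analysis" "HOL-Library.Landau_Symbols"
begin

definition kappa :: "real \<Rightarrow> complex \<Rightarrow> complex" where
  "kappa C \<zeta> = \<zeta> + of_real C * csqrt (\<zeta> + 1)"

definition quadratic_domain :: "real \<Rightarrow> complex set" where
  "quadratic_domain C = kappa C ` {\<zeta>. Re \<zeta> > 0}"

definition quadratic_germ :: "real \<Rightarrow> real \<Rightarrow> complex set" where
  "quadratic_germ C R = {\<zeta> \<in> quadratic_domain C. R \<le> Re \<zeta>}"

text \<open>Germs of maps on a standard quadratic domain are represented by total functions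
  \<open>complex \<Rightarrow> complex\<close>, of which only the values on some \<open>quadratic_germ C R\<close> matter.\<close>

definition holomorphic_germ :: "real \<Rightarrow> (complex \<Rightarrow> complex) \<Rightarrow> bool" where
  "holomorphic_germ C f \<longleftrightarrow> (\<exists>R>0. f holomorphic_on quadratic_germ C R)"

definition germ_eq :: "real \<Rightarrow> (complex \<Rightarrow> complex) \<Rightarrow> (complex \<Rightarrow> complex) \<Rightarrow> bool" where
  "germ_eq C f g \<longleftrightarrow> (\<exists>R>0. \<forall>\<zeta>\<in>quadratic_germ C R. f \<zeta> = g \<zeta>)"

definition Re_at_top_in :: "real \<Rightarrow> complex filter" where
  "Re_at_top_in C = inf (filtercomap Re at_top) (principal (quadratic_domain C))"

definition at_infinity_in :: "real \<Rightarrow> complex filter" where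
  "at_infinity_in C = inf at_infinity (principal (quadratic_domain C))"

inductive_set subsemigroup_gen :: "real set \<Rightarrow> real set" for G where
  gen: "x \<in> G \<Longrightarrow> x \<in> subsemigroup_gen G"
| add: "x \<in> subsemigroup_gen G \<Longrightarrow> y \<in> subsemigroup_gen G \<Longrightarrow> x + y \<in> subsemigroup_gen G"

text \<open>Exponents and coefficients are indexed from 0: the pair \<open>a i\<close>, \<open>P i\<close> is the
  \<open>(i + 1)\<close>-st exponential term of the series. Coefficients \<open>P i\<close> may vanish.\<close>

definition dulac_exponents :: "(nat \<Rightarrow> real) \<Rightarrow> bool" where
  "dulac_exponents a \<longleftrightarrow>
     strict_mono a \<and> (\<forall>i. a i > 0) \<and> filterlim a at_top sequentially \<and>
     (\<exists>G. finite G \<and> G \<subseteq> {0<..} \<and> range a \<subseteq> subsemigroup_gen G)"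

definition dulac_expansion ::
  "real \<Rightarrow> (complex \<Rightarrow> complex) \<Rightarrow> real \<Rightarrow> complex \<Rightarrow> (nat \<Rightarrow> complex poly) \<Rightarrow> (nat \<Rightarrow> real) \<Rightarrow> bool" where
  "dulac_expansion C f \<alpha> \<beta> P a \<longleftrightarrow>
     (\<forall>\<nu>>0. \<exists>N.
        (\<lambda>\<zeta>. f \<zeta> - of_real \<alpha> * \<zeta> - \<beta> - (\<Sum>i<N. poly (P i) \<zeta> * exp (- of_real (a i) * \<zeta>)))
          \<in> o[Re_at_top_in C](\<lambda>\<zeta>. exp (- of_real \<nu> * \<zeta>)))"

definition complex_dulac_germ :: "real \<Rightarrow> (complex \<Rightarrow> complex) \<Rightarrow> bool" where
  "complex_dulac_germ C f \<longleftrightarrow> holomorphic_germ C f \<and>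
     (\<exists>\<alpha> \<beta> P a. \<alpha> > 0 \<and> dulac_exponents a \<and> dulac_expansion C f \<alpha> \<beta> P a)"

definition parabolic_complex_dulac_germ :: "real \<Rightarrow> (complex \<Rightarrow> complex) \<Rightarrow> bool" where
  "parabolic_complex_dulac_germ C f \<longleftrightarrow> holomorphic_germ C f \<and>
     (\<exists>P a. dulac_exponents a \<and> dulac_expansion C f 1 0 P a)"

definition real_dulac_germ :: "real \<Rightarrow> (complex \<Rightarrow> complex) \<Rightarrow> bool" where
  "real_dulac_germ C f \<longleftrightarrow> complex_dulac_germ C f \<and>
     (\<exists>R>0. f ` {\<zeta> \<in> quadratic_germ C R. Im \<zeta> = 0} \<subseteq> {\<zeta> \<in> quadratic_domain C. Im \<zeta> = 0})"

definition hyperbolic_germ :: "real \<Rightarrow> complex \<Rightarrow> (complex \<Rightarrow> complex) \<Rightarrow> bool" where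
  "hyperbolic_germ C \<beta> f \<longleftrightarrow> holomorphic_germ C f \<and> Re \<beta> > 0 \<and>
     ((\<lambda>\<zeta>. f \<zeta> - (\<zeta> + \<beta>)) \<longlongrightarrow> 0) (at_infinity_in C)"

definition tangent_to_id_germ :: "real \<Rightarrow> (complex \<Rightarrow> complex) \<Rightarrow> bool" where
  "tangent_to_id_germ C f \<longleftrightarrow> holomorphic_germ C f \<and>
     ((\<lambda>\<zeta>. f \<zeta> - \<zeta>) \<longlongrightarrow> 0) (at_infinity_in C)"

text \<open>Near the boundary of the domain \<open>f\<close> may map points outside of it, where the representative
  is arbitrary. Hence the \<open>q\<close>-th iterate is compared with the identity only at points whose
  first \<open>q\<close> orbit points stay in the domain of the representative. The identity is tangent to
  the identity but not parabolic; it is the only such solution of \<open>\<phi> \<circ> f = \<phi> + \<beta>\<close> if \<open>f\<close> is the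
  translation by \<open>\<beta>\<close>.\<close>

definition iterate_eq_id_germ :: "real \<Rightarrow> nat \<Rightarrow> (complex \<Rightarrow> complex) \<Rightarrow> bool" where
  "iterate_eq_id_germ C q f \<longleftrightarrow>
     (\<exists>R>0. \<forall>\<zeta>. (\<forall>k<q. (f ^^ k) \<zeta> \<in> quadratic_germ C R) \<longrightarrow> (f ^^ q) \<zeta> = \<zeta>)"

definition parabolic_germ :: "real \<Rightarrow> (complex \<Rightarrow> complex) \<Rightarrow> bool" where
  "parabolic_germ C f \<longleftrightarrow> tangent_to_id_germ C f \<and> (\<forall>q\<ge>1. \<not> iterate_eq_id_germ C q f)"

text \<open>The equation \<open>\<phi> \<circ> f = \<phi> + \<beta>\<close> on an \<open>f\<close>-invariant germ of the domain. Once it holds on one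
  of them, it holds on every smaller one.\<close>

definition abel_equation_germ ::
  "real \<Rightarrow> complex \<Rightarrow> (complex \<Rightarrow> complex) \<Rightarrow> (complex \<Rightarrow> complex) \<Rightarrow> bool" where
  "abel_equation_germ C \<beta> f \<phi> \<longleftrightarrow>
     (\<exists>R>0. f holomorphic_on quadratic_germ C R \<and> \<phi> holomorphic_on quadratic_germ C R \<and>
        f ` quadratic_germ C R \<subseteq> quadratic_germ C R \<and>
        (\<forall>\<zeta>\<in>quadratic_germ C R. \<phi> (f \<zeta>) = \<phi> \<zeta> + \<beta>))"

end

theory Submission
  imports Defs "HOL-Real_Asymp.Real_Asymp"
    "HOL-Computational_Algebra.Fundamental_Theorem_Algebra"
begin

text \<open>Far to the right a hyperbolic germ \<open>f\<close> moves points by almost \<open>\<beta>\<close>, and it maps the domain into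
  itself because the boundary becomes steep there (\<open>quadratic_domain_translate\<close>). Since the
  displacement error \<open>g \<zeta> = f \<zeta> - \<zeta> - \<beta>\<close> is exponentially small, the limit of \<open>(f ^^ n) \<zeta> - n * \<beta>\<close> exists:
  it is \<open>\<phi> \<zeta> = \<zeta> + \<Phi> \<zeta>\<close>, where \<open>\<Phi> \<zeta>\<close> (called \<open>correction\<close> below) is the sum of \<open>g ((f ^^ n) \<zeta>)\<close> over all \<open>n\<close>.
  The series converges uniformly, so \<open>\<phi>\<close> is holomorphic, and shifting the index gives \<open>\<phi> \<circ> f = \<phi> + \<beta>\<close>.
  The difference of two solutions is constant along orbits and tends to 0 along them, whence
  uniqueness (\<open>invariant_function_eq_0\<close>). If \<open>f\<close> is real on the real axis, then so is the series.

  The asymptotic expansion of \<open>\<Phi>\<close> is found without expanding the iterates. For every order \<open>\<nu>\<close> a finite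
  exponential sum \<open>T\<close> is built for which \<open>g + T \<circ> f - T\<close> is of order \<open>exp (- \<nu> \<zeta>)\<close>
  (\<open>homological_approx\<close>): each term requires solving \<open>exp (- s \<beta>) q (\<zeta> + \<beta>) - q \<zeta> = p \<zeta>\<close> for a
  polynomial \<open>q\<close>, which is possible since \<open>Re \<beta> > 0\<close> and so \<open>exp (- s \<beta>) \<noteq> 1\<close>, and each round raises the
  exponents of the error by at least the smallest exponent. Then \<open>\<Phi> - T\<close> tends to 0 and has
  increments of order \<open>exp (- \<nu> \<zeta>)\<close> under \<open>f\<close>; summing them along orbits shows that \<open>\<Phi> - T\<close> itself has this
  order (\<open>bigo_decay_from_increment\<close>). By uniqueness of coefficients the sums for all orders
  are partial sums of one series (\<open>has_exp_expansion_imp_series\<close>), whose exponents enumerate the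
  finitely generated semigroup of the exponents of \<open>f\<close>. The domain need not be shrunk: \<open>C' = C\<close>.

  Finally, if some iterate of \<open>\<phi>\<close> is the identity, then \<open>\<Phi>\<close> vanishes
  (\<open>periodic_tangent_to_id\<close>), and \<open>\<phi> \<circ> f = \<phi> + \<beta>\<close> says that \<open>f\<close> is the translation by \<open>\<beta>\<close>.\<close>

section \<open>Geometry of standard quadratic domains\<close>

text \<open>Solving \<open>kappa C \<zeta> = w\<close> as a quadratic equation for \<open>csqrt (\<zeta> + 1)\<close> gives
  \<open>csqrt (\<zeta> + 1) = csqrt (w + 1 + C\<^sup>2 / 4) - C / 2\<close>. Eliminating the square root turns membership of
  \<open>w\<close> in the domain into the inequality \<open>norm (w + 1 + C\<^sup>2 / 4) < domain_radius C (Re w)\<close>: for a given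
  real part it bounds the distance to the point \<open>- (1 + C\<^sup>2 / 4)\<close>.\<close>

definition domain_radius :: "real \<Rightarrow> real \<Rightarrow> real" where
  "domain_radius C x = 2 * x\<^sup>2 / C\<^sup>2 + x + C\<^sup>2 / 4 - 1"

lemma quadratic_domain_iff:
  assumes "C > 0"
  shows "w \<in> quadratic_domain C \<longleftrightarrow>
    Re w > 0 \<and> norm (w + of_real (1 + C\<^sup>2 / 4)) < domain_radius C (Re w)"
proof
  assume "w \<in> quadratic_domain C"
  then obtain z where z: "Re z > 0" "w = kappa C z"
    by (auto simp: quadratic_domain_def)
  define a b where "a = Re (csqrt (z + 1))" and "b = Im (csqrt (z + 1))"
  have s: "csqrt (z + 1) = Complex a b" by (simp add: a_def b_def complex_eq_iff)
  have sq: "z + 1 = (Complex a b)\<^sup>2" by (metis power2_csqrt s)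
  have a0: "a \<ge> 0" unfolding a_def by (rule Re_csqrt)
  have y: "a\<^sup>2 - b\<^sup>2 - 1 > 0"
    using z(1) arg_cong[OF sq, of Re] by (simp add: power2_eq_square)
  have a: "a > 0"
  proof (rule ccontr)
    assume "\<not> a > 0"
    with a0 have "a = 0" by simp
    with y show False by (simp add: not_less[symmetric]) (smt (verit) zero_le_power2)
  qed
  have w: "w = (Complex a b)\<^sup>2 - 1 + of_real C * Complex a b"
    using z(2) sq s unfolding kappa_def by (metis add_diff_cancel_right')
  have Rew: "Re w = (a\<^sup>2 - b\<^sup>2 - 1) + C * a"
    unfolding w by (simp add: power2_eq_square)
  have "w + of_real (1 + C\<^sup>2 / 4) = (Complex (a + C / 2) b)\<^sup>2"
    unfolding w by (simp add: complex_eq_iff power2_eq_square field_simps)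
  then have n: "norm (w + of_real (1 + C\<^sup>2 / 4)) = (a + C / 2)\<^sup>2 + b\<^sup>2"
    by (simp add: norm_power cmod_power2)
  define y where "y = a\<^sup>2 - b\<^sup>2 - 1"
  have y0: "y > 0" using y y_def by simp
  have "domain_radius C (Re w) - ((a + C / 2)\<^sup>2 + b\<^sup>2) = 2 * y\<^sup>2 / C\<^sup>2 + 4 * y * a / C + 2 * y"
    using assms unfolding domain_radius_def Rew y_def[symmetric]
    by (simp add: field_simps power2_eq_square y_def)
  moreover have "2 * y\<^sup>2 / C\<^sup>2 + 4 * y * a / C + 2 * y > 0"
    using a y0 assms by (intro add_pos_pos) auto
  moreover have "Re w > 0" unfolding Rew using y a assms by (intro add_pos_pos) auto
  ultimately show "Re w > 0 \<and> norm (w + of_real (1 + C\<^sup>2 / 4)) < domain_radius C (Re w)"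
    unfolding n by linarith
next
  assume A: "Re w > 0 \<and> norm (w + of_real (1 + C\<^sup>2 / 4)) < domain_radius C (Re w)"
  define p q where "p = Re (csqrt (w + of_real (1 + C\<^sup>2 / 4)))"
    and "q = Im (csqrt (w + of_real (1 + C\<^sup>2 / 4)))"
  have sq: "w + of_real (1 + C\<^sup>2 / 4) = (Complex p q)\<^sup>2"
    by (metis power2_csqrt p_def q_def complex_surj)
  have n: "norm (w + of_real (1 + C\<^sup>2 / 4)) = p\<^sup>2 + q\<^sup>2"
    unfolding sq by (simp add: norm_power cmod_power2)
  have re: "Re w + 1 + C\<^sup>2 / 4 = p\<^sup>2 - q\<^sup>2"
    using arg_cong[OF sq, of Re] by (simp add: power2_eq_square)
  have p0: "p \<ge> 0" unfolding p_def by (rule Re_csqrt)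
  have "C\<^sup>2 / 4 < p\<^sup>2" using re A zero_le_power2[of q] by linarith
  then have "(C / 2)\<^sup>2 < p\<^sup>2" by (simp add: power_divide)
  then have p: "p > C / 2" using p0 by (rule power2_less_imp_less)
  have "p\<^sup>2 < (Re w)\<^sup>2 / C\<^sup>2 + Re w + C\<^sup>2 / 4"
    using A re unfolding n domain_radius_def by argo
  also have "\<dots> = (Re w / C + C / 2)\<^sup>2"
    using assms by (simp add: power2_sum power_divide)
  finally have "p\<^sup>2 < (Re w / C + C / 2)\<^sup>2" .
  then have "p < Re w / C + C / 2"
    by (rule power2_less_imp_less) (use A assms in simp)
  then have "C * p < Re w + C\<^sup>2 / 2" using assms by (simp add: field_simps power2_eq_square)
  then have big: "(p - C / 2)\<^sup>2 - q\<^sup>2 > 1"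
    using re by (simp add: power2_eq_square field_simps)
  define s where "s = Complex (p - C / 2) q"
  have "Re (s\<^sup>2 - 1) > 0" using big by (simp add: s_def power2_eq_square)
  moreover have "csqrt (s\<^sup>2) = s"
    by (rule csqrt_square) (use p in \<open>simp add: s_def\<close>)
  then have "kappa C (s\<^sup>2 - 1) = s\<^sup>2 - 1 + of_real C * s" by (simp add: kappa_def)
  then have "kappa C (s\<^sup>2 - 1) = w"
    using sq by (simp add: s_def complex_eq_iff power2_eq_square field_simps)
  ultimately show "w \<in> quadratic_domain C"
    unfolding quadratic_domain_def by (intro image_eqI[of _ _ "s\<^sup>2 - 1"]) auto
qed

lemma quadratic_domain_Re_pos: "C > 0 \<Longrightarrow> w \<in> quadratic_domain C \<Longrightarrow> Re w > 0"
  by (simp add: quadratic_domain_iff)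

lemma open_quadratic_domain:
  assumes "C > 0"
  shows "open (quadratic_domain C)"
proof -
  have "quadratic_domain C =
      {w. 0 < Re w} \<inter> {w. norm (w + of_real (1 + C\<^sup>2 / 4)) < domain_radius C (Re w)}"
    using quadratic_domain_iff[OF assms] by auto
  also have "open \<dots>"
    unfolding domain_radius_def
    by (intro open_Int open_Collect_less continuous_intros) (use assms in auto)
  finally show ?thesis .
qed

lemma quadratic_domain_norm_less:
  assumes "C > 0" "w \<in> quadratic_domain C"
  shows "norm w < 2 * (Re w)\<^sup>2 / C\<^sup>2 + Re w + C\<^sup>2 / 2"
proof -
  have "norm w \<le> norm (w + of_real (1 + C\<^sup>2 / 4)) + norm (of_real (1 + C\<^sup>2 / 4) :: complex)"
    by norm
  also have "norm (of_real (1 + C\<^sup>2 / 4) :: complex) = 1 + C\<^sup>2 / 4"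
    unfolding norm_of_real by simp
  finally show ?thesis
    using assms by (auto simp: quadratic_domain_iff domain_radius_def)
qed

text \<open>The parabola-like boundary becomes steep far out, so that a translation by a vector with positive
  real part keeps points that are far enough to the right in the domain.\<close>

lemma quadratic_domain_translate:
  assumes "C > 0" "w \<in> quadratic_domain C" "Re b > 0" "norm b * C\<^sup>2 \<le> 4 * Re w * Re b"
  shows "w + b \<in> quadratic_domain C"
proof -
  have "norm (w + b + of_real (1 + C\<^sup>2 / 4)) \<le> norm (w + of_real (1 + C\<^sup>2 / 4)) + norm b"
    by norm
  also have "\<dots> < domain_radius C (Re w) + 4 * Re w * Re b / C\<^sup>2"
  proof (rule add_less_le_mono)
    show "norm b \<le> 4 * Re w * Re b / C\<^sup>2" using assms by (simp add: pos_le_divide_eq)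
  qed (use assms in \<open>auto simp: quadratic_domain_iff\<close>)
  also have "\<dots> \<le> domain_radius C (Re (w + b))"
  proof -
    have "domain_radius C (Re w + Re b) =
        domain_radius C (Re w) + 4 * Re w * Re b / C\<^sup>2 + 2 * (Re b)\<^sup>2 / C\<^sup>2 + Re b"
      using assms(1) by (simp add: domain_radius_def field_simps power2_eq_square)
    moreover have "2 * (Re b)\<^sup>2 / C\<^sup>2 + Re b \<ge> 0" using assms by simp
    ultimately show ?thesis by simp
  qed
  finally show ?thesis using assms by (auto simp: quadratic_domain_iff)
qed

text \<open>In particular every horizontal half-strip far enough to the right lies in the domain.\<close>

lemma half_strip_subset_quadratic_domain:
  assumes "C > 0" "Re w > C * (1 + \<bar>Im w\<bar>)"
  shows "w \<in> quadratic_domain C"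
proof -
  let ?t = "1 + \<bar>Im w\<bar>"
  have pos: "C * ?t > 0" using assms(1) by (intro mult_pos_pos) auto
  then have x: "Re w > 0" using assms(2) by linarith
  have "norm (w + of_real (1 + C\<^sup>2 / 4)) \<le> \<bar>Re w + (1 + C\<^sup>2 / 4)\<bar> + \<bar>Im w\<bar>"
    using cmod_le[of "w + of_real (1 + C\<^sup>2 / 4)"] by simp
  also have "\<dots> = Re w + 1 + C\<^sup>2 / 4 + \<bar>Im w\<bar>" using x by simp
  also have "\<dots> < domain_radius C (Re w)"
  proof -
    have "(C * ?t)\<^sup>2 < (Re w)\<^sup>2"
      using assms pos by (intro power_strict_mono) auto
    then have "?t\<^sup>2 < (Re w)\<^sup>2 / C\<^sup>2"
      unfolding power_mult_distrib using assms(1) by (simp add: pos_less_divide_eq mult.commute)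
    moreover have "?t \<le> ?t\<^sup>2" by (intro self_le_power) auto
    ultimately have "?t < (Re w)\<^sup>2 / C\<^sup>2" by linarith
    then show ?thesis unfolding domain_radius_def by simp
  qed
  finally show ?thesis using x assms(1) by (simp add: quadratic_domain_iff)
qed

text \<open>Every point is joined to the real axis by a vertical segment.\<close>

lemma connected_quadratic_domain_right:
  assumes "C > 0"
  shows "connected {w \<in> quadratic_domain C. X < Re w}" (is "connected ?D")
proof -
  define ray where "ray = complex_of_real ` {max C X<..}"
  define A where "A w = closed_segment w (of_real (Re w)) \<union> ray" for w
  have ray_D: "ray \<subseteq> ?D"
    using half_strip_subset_quadratic_domain[OF assms] by (auto simp: ray_def)
  have on_axis: "of_real (Re w) \<in> ray" if w: "w \<in> ?D" for w
  proof -
    have "Re w + (1 + C\<^sup>2 / 4) \<le> norm (w + of_real (1 + C\<^sup>2 / 4))"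
      using complex_Re_le_cmod[of "w + of_real (1 + C\<^sup>2 / 4)"] by simp
    moreover have "norm (w + of_real (1 + C\<^sup>2 / 4)) < domain_radius C (Re w)" "Re w > 0"
      using w assms by (auto simp: quadratic_domain_iff)
    ultimately have "1 < (Re w)\<^sup>2 / C\<^sup>2" unfolding domain_radius_def by linarith
    then have "C\<^sup>2 < (Re w)\<^sup>2" using assms by (simp add: pos_less_divide_eq)
    then have "C < Re w" using \<open>Re w > 0\<close> by (intro power2_less_imp_less[of C]) auto
    then show ?thesis using w by (auto simp: ray_def)
  qed
  have seg: "closed_segment w (of_real (Re w)) \<subseteq> ?D" if w: "w \<in> ?D" for w
  proof
    fix z assume "z \<in> closed_segment w (of_real (Re w))"
    then obtain t where t: "0 \<le> t" "t \<le> 1" "z = (1 - t) *\<^sub>R w + t *\<^sub>R of_real (Re w)"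
      by (auto simp: in_segment)
    have Rez: "Re z = Re w" and Imz: "Im z = (1 - t) * Im w"
      by (simp_all add: t(3) algebra_simps)
    have "\<bar>Im z\<bar> \<le> \<bar>Im w\<bar>"
      using t unfolding Imz abs_mult by (intro mult_left_le_one_le) auto
    then have "(Im z)\<^sup>2 \<le> (Im w)\<^sup>2" by (rule abs_le_square_iff[THEN iffD1])
    then have "norm (z + of_real (1 + C\<^sup>2 / 4)) \<le> norm (w + of_real (1 + C\<^sup>2 / 4))"
      unfolding cmod_def by (simp add: Rez)
    then show "z \<in> ?D" using w assms Rez by (auto simp: quadratic_domain_iff)
  qed
  have conn_ray: "connected ray"
    unfolding ray_def by (intro connected_continuous_image continuous_intros) auto
  have conn: "connected (A w)" if "w \<in> ?D" for w
    unfolding A_def using on_axis[OF that] conn_ray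
    by (intro connected_Un) auto
  have "?D = \<Union> (A ` ?D)"
    using seg ray_D unfolding A_def by fastforce
  moreover have "connected (\<Union> (A ` ?D))"
  proof (rule connected_Union)
    have "of_real (max C X + 1) \<in> ray"
      unfolding ray_def by (intro imageI) simp
    then show "\<Inter> (A ` ?D) \<noteq> {}" unfolding A_def by blast
  qed (use conn in auto)
  ultimately show ?thesis by simp
qed

lemma eventually_Re_at_top_in:
  "eventually P (Re_at_top_in C) \<longleftrightarrow> (\<exists>X. \<forall>\<zeta>\<in>quadratic_domain C. X \<le> Re \<zeta> \<longrightarrow> P \<zeta>)"
proof -
  have "eventually P (Re_at_top_in C) \<longleftrightarrow>
      (\<exists>X. \<forall>\<zeta>. X \<le> Re \<zeta> \<longrightarrow> \<zeta> \<in> quadratic_domain C \<longrightarrow> P \<zeta>)"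
    unfolding Re_at_top_in_def eventually_inf_principal eventually_filtercomap_at_top_linorder ..
  then show ?thesis by blast
qed

text \<open>Since the norm is at most quadratic in the real part, both filters of the domain agree.\<close>

lemma at_infinity_in_eq:
  assumes "C > 0"
  shows "at_infinity_in C = Re_at_top_in C"
proof (rule antisym; rule filter_leI)
  fix P assume "eventually P (Re_at_top_in C)"
  then obtain X where X: "\<And>\<zeta>. \<zeta> \<in> quadratic_domain C \<Longrightarrow> X \<le> Re \<zeta> \<Longrightarrow> P \<zeta>"
    by (auto simp: eventually_Re_at_top_in)
  define B where "B = 2 * X\<^sup>2 / C\<^sup>2 + X + C\<^sup>2 / 2"
  have "P \<zeta>" if "B \<le> norm \<zeta>" "\<zeta> \<in> quadratic_domain C" for \<zeta>
  proof (rule X[OF that(2)], rule ccontr)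
    assume less: "\<not> X \<le> Re \<zeta>"
    have "Re \<zeta> > 0" using quadratic_domain_Re_pos[OF assms that(2)] .
    with less have "2 * (Re \<zeta>)\<^sup>2 / C\<^sup>2 + Re \<zeta> + C\<^sup>2 / 2 \<le> B"
      unfolding B_def using assms
      by (intro add_mono divide_right_mono mult_left_mono power_mono) auto
    with quadratic_domain_norm_less[OF assms that(2)] that(1) show False by linarith
  qed
  then show "eventually P (at_infinity_in C)"
    unfolding at_infinity_in_def eventually_inf_principal eventually_at_infinity by blast
next
  fix P assume "eventually P (at_infinity_in C)"
  then obtain B where B: "\<And>\<zeta>. B \<le> norm \<zeta> \<Longrightarrow> \<zeta> \<in> quadratic_domain C \<Longrightarrow> P \<zeta>"
    unfolding at_infinity_in_def eventually_inf_principal eventually_at_infinity by blast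
  then show "eventually P (Re_at_top_in C)"
    unfolding eventually_Re_at_top_in by (meson complex_Re_le_cmod order_trans)
qed

lemma filterlim_of_real_Re_at_top_in:
  assumes "C > 0"
  shows "filterlim complex_of_real (Re_at_top_in C) at_top"
  unfolding filterlim_iff eventually_Re_at_top_in
proof safe
  fix P X assume X: "\<forall>\<zeta>\<in>quadratic_domain C. X \<le> Re \<zeta> \<longrightarrow> P \<zeta>"
  have "complex_of_real x \<in> quadratic_domain C" if "x > C" for x
    using that half_strip_subset_quadratic_domain[OF assms, of "of_real x"] by simp
  then have "\<forall>x\<ge>max X (C + 1). P (complex_of_real x)" using X by auto
  then show "\<forall>\<^sub>F x in at_top. P (complex_of_real x)"
    unfolding eventually_at_top_linorder by blast
qed

section \<open>Exponential scales\<close>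

text \<open>The scale of orders of decay. Polynomials grow more slowly than every \<open>decay \<nu>\<close> with \<open>\<nu> < 0\<close>,
  because in a quadratic domain \<open>\<zeta>\<close> is of at most quadratic size in \<open>Re \<zeta>\<close>.\<close>

abbreviation decay :: "real \<Rightarrow> complex \<Rightarrow> complex" where
  "decay \<nu> \<equiv> \<lambda>\<zeta>. exp (- of_real \<nu> * \<zeta>)"

lemma decay_mult: "decay \<mu> \<zeta> * decay \<nu> \<zeta> = decay (\<mu> + \<nu>) \<zeta>"
  by (simp add: exp_add[symmetric] algebra_simps)

lemma decay_tendsto_0:
  assumes "\<nu> > 0"
  shows "(decay \<nu> \<longlongrightarrow> 0) (Re_at_top_in C)"
proof -
  have "filterlim Re at_top (Re_at_top_in C)"
    unfolding filterlim_at_top eventually_Re_at_top_in by blast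
  moreover have "((\<lambda>x. exp (- \<nu> * x)) \<longlongrightarrow> 0) at_top" using assms by real_asymp
  ultimately have "((\<lambda>\<zeta>. exp (- \<nu> * Re \<zeta>)) \<longlongrightarrow> 0) (Re_at_top_in C)"
    by (rule filterlim_compose[rotated])
  then show ?thesis by (subst tendsto_norm_zero_iff[symmetric]) (simp add: norm_exp)
qed

lemma decay_smallo:
  assumes "\<nu> < \<mu>"
  shows "decay \<mu> \<in> o[Re_at_top_in C](decay \<nu>)"
proof (rule smalloI_tendsto)
  have "decay \<mu> \<zeta> / decay \<nu> \<zeta> = decay (\<mu> - \<nu>) \<zeta>" for \<zeta>
    by (simp add: exp_diff[symmetric] algebra_simps)
  then show "((\<lambda>\<zeta>. decay \<mu> \<zeta> / decay \<nu> \<zeta>) \<longlongrightarrow> 0) (Re_at_top_in C)"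
    using decay_tendsto_0[of "\<mu> - \<nu>" C] assms by simp
qed auto

lemma decay_bigo: "\<nu> \<le> \<mu> \<Longrightarrow> decay \<mu> \<in> O[Re_at_top_in C](decay \<nu>)"
  using decay_smallo[of \<nu> \<mu> C] by (cases "\<nu> = \<mu>") (auto intro: landau_o.small_imp_big)

lemma bigo_decay_mono:
  "h \<in> O[Re_at_top_in C](decay \<mu>) \<Longrightarrow> \<nu> \<le> \<mu> \<Longrightarrow> h \<in> O[Re_at_top_in C](decay \<nu>)"
  by (rule landau_o.big.trans[OF _ decay_bigo])

lemma bigo_decay_imp_smallo:
  "h \<in> O[Re_at_top_in C](decay \<mu>) \<Longrightarrow> \<nu> < \<mu> \<Longrightarrow> h \<in> o[Re_at_top_in C](decay \<nu>)"
  by (rule landau_o.big_small_trans[OF _ decay_smallo])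

lemma bigo_decay_mult:
  assumes "h \<in> O[Re_at_top_in C](decay \<mu>)" "k \<in> O[Re_at_top_in C](decay \<nu>)" "\<rho> \<le> \<mu> + \<nu>"
  shows "(\<lambda>\<zeta>. h \<zeta> * k \<zeta>) \<in> O[Re_at_top_in C](decay \<rho>)"
  using landau_o.big.mult[OF assms(1,2)] unfolding decay_mult
  by (rule bigo_decay_mono[OF _ assms(3)])

lemma bigo_decay_tendsto_0:
  assumes "h \<in> O[Re_at_top_in C](decay \<nu>)" "\<nu> > 0"
  shows "(h \<longlongrightarrow> 0) (Re_at_top_in C)"
proof -
  have "h \<in> o[Re_at_top_in C](decay 0)" by (rule bigo_decay_imp_smallo[OF assms])
  then show ?thesis using smalloD_tendsto by fastforce
qed

lemma const_bigo_decay: "\<nu> \<le> 0 \<Longrightarrow> (\<lambda>_. c) \<in> O[Re_at_top_in C](decay \<nu>)"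
  by (rule bigo_decay_mono[of _ _ 0]) auto

lemma ident_bigo_decay:
  assumes "C > 0" "\<nu> < 0"
  shows "(\<lambda>\<zeta>. \<zeta>) \<in> O[Re_at_top_in C](decay \<nu>)"
proof -
  have "\<forall>\<^sub>F x in at_top. 2 * x\<^sup>2 / C\<^sup>2 + x + C\<^sup>2 / 2 \<le> exp (- \<nu> * x)"
    using assms by real_asymp
  then obtain X where "\<And>x. x \<ge> X \<Longrightarrow> 2 * x\<^sup>2 / C\<^sup>2 + x + C\<^sup>2 / 2 \<le> exp (- \<nu> * x)"
    by (auto simp: eventually_at_top_linorder)
  then have "\<forall>\<^sub>F \<zeta> in Re_at_top_in C. norm \<zeta> \<le> 1 * norm (decay \<nu> \<zeta>)"
    unfolding eventually_Re_at_top_in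
    using quadratic_domain_norm_less[OF assms(1)]
    by (intro exI[of _ X]) (fastforce simp: norm_exp)
  then show ?thesis by (rule bigoI)
qed

lemma poly_bigo_decay:
  assumes "C > 0" "\<nu> < 0"
  shows "poly p \<in> O[Re_at_top_in C](decay \<nu>)"
  using assms(2)
proof (induction p arbitrary: \<nu>)
  case 0
  then show ?case by simp
next
  case (pCons a p)
  have "(\<lambda>\<zeta>. \<zeta> * poly p \<zeta>) \<in> O[Re_at_top_in C](decay \<nu>)"
    by (rule bigo_decay_mult[OF ident_bigo_decay[OF assms(1), of "\<nu> / 2"] pCons.IH[of "\<nu> / 2"]])
      (use pCons in auto)
  then have "(\<lambda>\<zeta>. a + \<zeta> * poly p \<zeta>) \<in> O[Re_at_top_in C](decay \<nu>)"
    using pCons by (intro sum_in_bigo const_bigo_decay) auto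
  then show ?case by (simp add: fun_eq_iff[symmetric])
qed

lemma term_bigo_decay:
  assumes "C > 0" "\<nu> < s"
  shows "(\<lambda>\<zeta>. poly p \<zeta> * decay s \<zeta>) \<in> O[Re_at_top_in C](decay \<nu>)"
  by (rule bigo_decay_mult[OF poly_bigo_decay[OF assms(1), of "\<nu> - s"], of _ s]) (use assms in auto)

text \<open>A polynomial that vanishes at infinity is zero; the positive real axis suffices to see this.\<close>

lemma poly_tendsto_0_imp_0:
  assumes "C > 0" "(poly p \<longlongrightarrow> 0) (Re_at_top_in C)"
  shows "p = 0"
proof (cases p)
  case (pCons a q)
  have lim: "((\<lambda>x. poly p (complex_of_real x)) \<longlongrightarrow> 0) at_top"
    by (rule filterlim_compose[OF assms(2) filterlim_of_real_Re_at_top_in[OF assms(1)]])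
  show ?thesis
  proof (cases "q = 0")
    case True
    then show ?thesis using lim pCons by (simp add: tendsto_const_iff)
  next
    case False
    from poly_infinity[OF this, of 1 a] obtain r
      where r: "\<And>z. r \<le> norm z \<Longrightarrow> 1 \<le> norm (poly p z)"
      unfolding pCons by blast
    have "\<forall>\<^sub>F x in at_top. norm (poly p (complex_of_real x)) < 1"
      using lim[THEN tendstoD, of 1] by simp
    moreover have "\<forall>\<^sub>F x in at_top. r \<le> norm (complex_of_real x)"
      using eventually_ge_at_top[of "max r 0"] by eventually_elim simp
    ultimately have "\<forall>\<^sub>F x::real in at_top. False"
      by eventually_elim (meson r not_less)
    then show ?thesis by simp
  qed
qed

section \<open>Finite exponential sums\<close>

text \<open>Finite sums of terms \<open>p(\<zeta>) exp (- s \<zeta>)\<close> with a polynomial \<open>p\<close> and an exponent \<open>s \<in> T\<close>. Exponents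
  may be repeated, which makes the closure under sums and products immediate.\<close>

inductive expsum :: "real set \<Rightarrow> (complex \<Rightarrow> complex) \<Rightarrow> bool" for T where
  zero: "expsum T (\<lambda>_. 0)"
| add_term: "s \<in> T \<Longrightarrow> expsum T k \<Longrightarrow> expsum T (\<lambda>\<zeta>. poly p \<zeta> * decay s \<zeta> + k \<zeta>)"

lemma expsum_term: "s \<in> T \<Longrightarrow> expsum T (\<lambda>\<zeta>. poly p \<zeta> * decay s \<zeta>)"
  using add_term[OF _ zero] by simp

lemma expsum_mono: "expsum T k \<Longrightarrow> T \<subseteq> U \<Longrightarrow> expsum U k"
proof (induction rule: expsum.induct)
  case (add_term s k p)
  then show ?case by (intro expsum.add_term) auto
qed (rule expsum.zero)

lemma expsum_add:
  assumes "expsum T h" "expsum T k"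
  shows "expsum T (\<lambda>\<zeta>. h \<zeta> + k \<zeta>)"
  using assms(1)
proof (induction rule: expsum.induct)
  case zero
  then show ?case using assms(2) by simp
next
  case (add_term s h p)
  from expsum.add_term[OF add_term(1,3)] show ?case by (simp only: add.assoc)
qed

lemma expsum_sum: "(\<And>i. i \<in> I \<Longrightarrow> expsum T (k i)) \<Longrightarrow> expsum T (\<lambda>\<zeta>. \<Sum>i\<in>I. k i \<zeta>)"
  by (induction I rule: infinite_finite_induct) (auto intro: expsum.zero expsum_add)

lemma expsum_term_mult:
  assumes "expsum U k" "\<And>u. u \<in> U \<Longrightarrow> s + u \<in> V"
  shows "expsum V (\<lambda>\<zeta>. poly p \<zeta> * decay s \<zeta> * k \<zeta>)"
  using assms
proof (induction rule: expsum.induct)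
  case zero
  then show ?case by (simp add: expsum.zero)
next
  case (add_term u k q)
  have "expsum V (\<lambda>\<zeta>. poly (p * q) \<zeta> * decay (s + u) \<zeta> + poly p \<zeta> * decay s \<zeta> * k \<zeta>)"
    using add_term by (intro expsum.add_term) auto
  then show ?case unfolding decay_mult[symmetric] by (simp add: algebra_simps)
qed

lemma expsum_mult:
  assumes "expsum T h" "expsum U k" "\<And>s u. s \<in> T \<Longrightarrow> u \<in> U \<Longrightarrow> s + u \<in> V"
  shows "expsum V (\<lambda>\<zeta>. h \<zeta> * k \<zeta>)"
  using assms(1)
proof (induction rule: expsum.induct)
  case zero
  then show ?case by (simp add: expsum.zero)
next
  case (add_term s h p)
  have "expsum V (\<lambda>\<zeta>. poly p \<zeta> * decay s \<zeta> * k \<zeta> + h \<zeta> * k \<zeta>)"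
    using add_term assms by (intro expsum_add expsum_term_mult[OF assms(2)]) auto
  then show ?case by (simp add: distrib_right)
qed

lemma expsum_bigo:
  assumes "C > 0" "expsum T k" "\<And>s. s \<in> T \<Longrightarrow> \<nu> < s"
  shows "k \<in> O[Re_at_top_in C](decay \<nu>)"
  using assms(2)
proof (induction rule: expsum.induct)
  case (add_term s k p)
  then show ?case by (intro sum_in_bigo term_bigo_decay assms) auto
qed simp

section \<open>Functions with exponential asymptotic expansions\<close>

text \<open>A function has an expansion with exponents in \<open>T\<close> if to every order it is approximated by a
  finite exponential sum. The sums for different orders need not be related; that they are partial
  sums of one series follows from the uniqueness of coefficients.\<close>

definition has_exp_expansion :: "real \<Rightarrow> real set \<Rightarrow> (complex \<Rightarrow> complex) \<Rightarrow> bool" where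
  "has_exp_expansion C T h \<longleftrightarrow>
     (\<forall>\<nu>. \<exists>k. expsum T k \<and> (\<lambda>\<zeta>. h \<zeta> - k \<zeta>) \<in> O[Re_at_top_in C](decay \<nu>))"

lemma has_exp_expansionE:
  assumes "has_exp_expansion C T h"
  obtains k where "expsum T k" "(\<lambda>\<zeta>. h \<zeta> - k \<zeta>) \<in> O[Re_at_top_in C](decay \<nu>)"
  using assms unfolding has_exp_expansion_def by blast

lemma expsum_has_exp_expansion: "expsum T k \<Longrightarrow> has_exp_expansion C T k"
  unfolding has_exp_expansion_def by (auto intro!: exI[of _ k])

lemma has_exp_expansion_approx:
  assumes "\<And>\<nu>. \<exists>k. has_exp_expansion C T k \<and> (\<lambda>\<zeta>. h \<zeta> - k \<zeta>) \<in> O[Re_at_top_in C](decay \<nu>)"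
  shows "has_exp_expansion C T h"
  unfolding has_exp_expansion_def
proof
  fix \<nu>
  obtain k where k: "has_exp_expansion C T k" "(\<lambda>\<zeta>. h \<zeta> - k \<zeta>) \<in> O[Re_at_top_in C](decay \<nu>)"
    using assms by blast
  obtain l where l: "expsum T l" "(\<lambda>\<zeta>. k \<zeta> - l \<zeta>) \<in> O[Re_at_top_in C](decay \<nu>)"
    using k(1) by (rule has_exp_expansionE)
  show "\<exists>k. expsum T k \<and> (\<lambda>\<zeta>. h \<zeta> - k \<zeta>) \<in> O[Re_at_top_in C](decay \<nu>)"
    using l(1) sum_in_bigo(1)[OF k(2) l(2)] by auto
qed

lemma has_exp_expansion_mono:
  "has_exp_expansion C T h \<Longrightarrow> T \<subseteq> U \<Longrightarrow> has_exp_expansion C U h"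
  unfolding has_exp_expansion_def by (meson expsum_mono)

lemma has_exp_expansion_add:
  assumes "has_exp_expansion C T h" "has_exp_expansion C T k"
  shows "has_exp_expansion C T (\<lambda>\<zeta>. h \<zeta> + k \<zeta>)"
  unfolding has_exp_expansion_def
proof
  fix \<nu>
  obtain h' where h': "expsum T h'" "(\<lambda>\<zeta>. h \<zeta> - h' \<zeta>) \<in> O[Re_at_top_in C](decay \<nu>)"
    using assms(1) by (rule has_exp_expansionE)
  obtain k' where k': "expsum T k'" "(\<lambda>\<zeta>. k \<zeta> - k' \<zeta>) \<in> O[Re_at_top_in C](decay \<nu>)"
    using assms(2) by (rule has_exp_expansionE)
  show "\<exists>l. expsum T l \<and> (\<lambda>\<zeta>. h \<zeta> + k \<zeta> - l \<zeta>) \<in> O[Re_at_top_in C](decay \<nu>)"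
    using expsum_add[OF h'(1) k'(1)] sum_in_bigo(1)[OF h'(2) k'(2)]
    by (intro exI[of _ "\<lambda>\<zeta>. h' \<zeta> + k' \<zeta>"]) (simp add: algebra_simps)
qed

lemma has_exp_expansion_bigo:
  assumes "C > 0" "has_exp_expansion C T h" "\<And>s. s \<in> T \<Longrightarrow> \<nu> < s"
  shows "h \<in> O[Re_at_top_in C](decay \<nu>)"
proof -
  obtain k where k: "expsum T k" "(\<lambda>\<zeta>. h \<zeta> - k \<zeta>) \<in> O[Re_at_top_in C](decay \<nu>)"
    using assms(2) by (rule has_exp_expansionE)
  show ?thesis using sum_in_bigo(1)[OF k(2) expsum_bigo[OF assms(1) k(1) assms(3)]] by simp
qed

lemma has_exp_expansion_mult:
  assumes C: "C > 0" and h: "has_exp_expansion C T h" and k: "has_exp_expansion C U k"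
    and "\<And>s u. s \<in> T \<Longrightarrow> u \<in> U \<Longrightarrow> s + u \<in> V"
    and T: "\<And>s. s \<in> T \<Longrightarrow> \<mu> < s" and U: "\<And>u. u \<in> U \<Longrightarrow> \<mu> < u"
  shows "has_exp_expansion C V (\<lambda>\<zeta>. h \<zeta> * k \<zeta>)"
  unfolding has_exp_expansion_def
proof
  fix \<nu>
  obtain h' where h': "expsum T h'" "(\<lambda>\<zeta>. h \<zeta> - h' \<zeta>) \<in> O[Re_at_top_in C](decay (\<nu> - \<mu>))"
    using h by (rule has_exp_expansionE)
  obtain k' where k': "expsum U k'" "(\<lambda>\<zeta>. k \<zeta> - k' \<zeta>) \<in> O[Re_at_top_in C](decay (\<nu> - \<mu>))"
    using k by (rule has_exp_expansionE)
  have "(\<lambda>\<zeta>. (h \<zeta> - h' \<zeta>) * k \<zeta>) \<in> O[Re_at_top_in C](decay \<nu>)"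
    by (rule bigo_decay_mult[OF h'(2) has_exp_expansion_bigo[OF C k U]]) auto
  moreover have "(\<lambda>\<zeta>. h' \<zeta> * (k \<zeta> - k' \<zeta>)) \<in> O[Re_at_top_in C](decay \<nu>)"
    by (rule bigo_decay_mult[OF expsum_bigo[OF C h'(1) T] k'(2)]) auto
  ultimately have "(\<lambda>\<zeta>. (h \<zeta> - h' \<zeta>) * k \<zeta> + h' \<zeta> * (k \<zeta> - k' \<zeta>)) \<in> O[Re_at_top_in C](decay \<nu>)"
    by (rule sum_in_bigo)
  then show "\<exists>l. expsum V l \<and> (\<lambda>\<zeta>. h \<zeta> * k \<zeta> - l \<zeta>) \<in> O[Re_at_top_in C](decay \<nu>)"
    using expsum_mult[OF h'(1) k'(1) assms(4)]
    by (intro exI[of _ "\<lambda>\<zeta>. h' \<zeta> * k' \<zeta>"]) (simp add: algebra_simps)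
qed

text \<open>A set of exponents that is closed under addition and bounded away from 0. Functions with
  expansions in \<open>S\<close> form an ideal in the ring of functions with expansions in \<open>insert 0 S\<close>.\<close>

locale exponent_semigroup =
  fixes C :: real and S :: "real set" and \<delta> :: real
  assumes C_pos: "C > 0"
    and \<delta>_pos: "\<delta> > 0"
    and exponent_ge: "s \<in> S \<Longrightarrow> \<delta> \<le> s"
    and exponent_add: "s \<in> S \<Longrightarrow> t \<in> S \<Longrightarrow> s + t \<in> S"
begin

lemma expansion_mult0:
  assumes "has_exp_expansion C (insert 0 S) h" "has_exp_expansion C (insert 0 S) k"
  shows "has_exp_expansion C (insert 0 S) (\<lambda>\<zeta>. h \<zeta> * k \<zeta>)"
  by (rule has_exp_expansion_mult[OF C_pos assms, of _ "- \<delta>"])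
    (use \<delta>_pos in \<open>auto dest: exponent_ge intro: exponent_add\<close>)

lemma expansion_mult_ideal:
  assumes "has_exp_expansion C S h" "has_exp_expansion C (insert 0 S) k"
  shows "has_exp_expansion C S (\<lambda>\<zeta>. h \<zeta> * k \<zeta>)"
  by (rule has_exp_expansion_mult[OF C_pos assms, of _ "- \<delta>"])
    (use \<delta>_pos in \<open>auto dest: exponent_ge intro: exponent_add\<close>)

lemma expansion_poly: "has_exp_expansion C (insert 0 S) (poly p)"
  using expsum_term[of 0 "insert 0 S" p] by (intro expsum_has_exp_expansion) simp

lemma expansion_const: "has_exp_expansion C (insert 0 S) (\<lambda>_. c)"
proof -
  have "poly [:c:] = (\<lambda>_. c)" by auto
  then show ?thesis using expansion_poly[of "[:c:]"] by metis
qed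

lemma expansion_poly_compose:
  assumes "has_exp_expansion C (insert 0 S) h"
  shows "has_exp_expansion C (insert 0 S) (\<lambda>\<zeta>. poly q (h \<zeta>))"
proof (induction q)
  case 0
  then show ?case using expansion_const by simp
next
  case (pCons a q)
  then show ?case
    using has_exp_expansion_add[OF expansion_const expansion_mult0[OF assms pCons.IH]] by simp
qed

lemma expansion_poly_perturb:
  assumes h: "has_exp_expansion C (insert 0 S) h" and g: "has_exp_expansion C S g"
  shows "has_exp_expansion C S (\<lambda>\<zeta>. poly q (h \<zeta> + g \<zeta>) - poly q (h \<zeta>))"
proof (induction q)
  case 0
  then show ?case using expsum_has_exp_expansion[OF expsum.zero] by simp
next
  case (pCons a q)
  have "has_exp_expansion C (insert 0 S) (\<lambda>\<zeta>. h \<zeta> + g \<zeta>)"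
    using has_exp_expansion_add[OF h has_exp_expansion_mono[OF g]] by blast
  from has_exp_expansion_add[OF expansion_mult_ideal[OF pCons.IH h]
      expansion_mult_ideal[OF g expansion_poly_compose[OF this, of q]]]
  show ?case by (simp add: algebra_simps)
qed

lemma expansion_bigo:
  "has_exp_expansion C S g \<Longrightarrow> \<nu> < \<delta> \<Longrightarrow> g \<in> O[Re_at_top_in C](decay \<nu>)"
  by (rule has_exp_expansion_bigo[OF C_pos]) (auto dest: exponent_ge)

text \<open>As \<open>g\<close> decays exponentially, Taylor polynomials of \<open>exp\<close> approximate \<open>exp (c * g)\<close> to any order.\<close>

lemma expansion_exp:
  assumes g: "has_exp_expansion C S g"
  shows "has_exp_expansion C S (\<lambda>\<zeta>. exp (c * g \<zeta>) - 1)"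
proof (rule has_exp_expansion_approx)
  fix \<nu>
  define h where "h \<zeta> = c * g \<zeta>" for \<zeta>
  have h: "has_exp_expansion C S h"
    using expansion_mult_ideal[OF g expansion_const[of c]] by (simp add: h_def[abs_def] mult.commute)
  have pow: "has_exp_expansion C S (\<lambda>\<zeta>. \<Sum>i<n. h \<zeta> ^ Suc i / fact (Suc i))" for n
  proof (induction n)
    case 0
    then show ?case using expsum_has_exp_expansion[OF expsum.zero] by simp
  next
    case (Suc n)
    have "has_exp_expansion C (insert 0 S) (\<lambda>\<zeta>. poly (monom (1 / fact (Suc n)) n) (h \<zeta>))"
      by (rule expansion_poly_compose[OF has_exp_expansion_mono[OF h]]) auto
    from has_exp_expansion_add[OF Suc expansion_mult_ideal[OF h this]]
    show ?case by (simp add: poly_monom)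
  qed
  obtain n :: nat where n: "\<nu> / (\<delta> / 2) < real n" using reals_Archimedean2 by blast
  have small: "h \<in> O[Re_at_top_in C](decay (\<delta> / 2))"
    using \<delta>_pos by (intro expansion_bigo h) auto
  have "\<forall>\<^sub>F \<zeta> in Re_at_top_in C. norm (h \<zeta>) < 1"
    using bigo_decay_tendsto_0[OF small] \<delta>_pos tendstoD[of h 0 _ 1] by simp
  then have "\<forall>\<^sub>F \<zeta> in Re_at_top_in C.
      norm (exp (h \<zeta>) - (\<Sum>i\<le>n. h \<zeta> ^ i / fact i)) \<le> exp 1 / fact n * norm (h \<zeta> ^ Suc n)"
  proof eventually_elim
    case (elim \<zeta>)
    have "norm (exp (h \<zeta>) - (\<Sum>i\<le>n. h \<zeta> ^ i / fact i))
        \<le> exp (norm (h \<zeta>)) * norm (h \<zeta>) ^ Suc n / fact n" by (rule Taylor_exp_field)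
    also have "\<dots> \<le> exp 1 * norm (h \<zeta>) ^ Suc n / fact n"
      using elim by (intro divide_right_mono mult_right_mono) auto
    finally show ?case by (simp add: norm_mult norm_power)
  qed
  then have "(\<lambda>\<zeta>. exp (h \<zeta>) - (\<Sum>i\<le>n. h \<zeta> ^ i / fact i)) \<in> O[Re_at_top_in C](\<lambda>\<zeta>. h \<zeta> ^ Suc n)"
    by (rule bigoI)
  also have "(\<lambda>\<zeta>. h \<zeta> ^ Suc n) \<in> O[Re_at_top_in C](\<lambda>\<zeta>. decay (\<delta> / 2) \<zeta> ^ Suc n)"
    by (rule landau_o.big_power[OF small])
  also have "(\<lambda>\<zeta>. decay (\<delta> / 2) \<zeta> ^ Suc n) = decay (real (Suc n) * (\<delta> / 2))"
    by (simp add: exp_of_nat_mult[symmetric] algebra_simps del: power_Suc)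
  also have "decay (real (Suc n) * (\<delta> / 2)) \<in> O[Re_at_top_in C](decay \<nu>)"
  proof (rule decay_bigo)
    have "\<nu> < real n * (\<delta> / 2)" using n \<delta>_pos by (simp add: pos_divide_less_eq)
    also have "\<dots> \<le> real (Suc n) * (\<delta> / 2)" using \<delta>_pos by (intro mult_right_mono) auto
    finally show "\<nu> \<le> real (Suc n) * (\<delta> / 2)" by simp
  qed
  finally have "(\<lambda>\<zeta>. (exp (h \<zeta>) - 1) - (\<Sum>i<n. h \<zeta> ^ Suc i / fact (Suc i)))
      \<in> O[Re_at_top_in C](decay \<nu>)"
    by (simp add: sum.atMost_shift diff_diff_eq)
  then show "\<exists>k. has_exp_expansion C S k \<and>
      (\<lambda>\<zeta>. exp (c * g \<zeta>) - 1 - k \<zeta>) \<in> O[Re_at_top_in C](decay \<nu>)"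
    unfolding h_def using pow[unfolded h_def] by blast
qed

end

section \<open>The homological equation\<close>

text \<open>The operator \<open>q \<mapsto> l * q (\<zeta> + \<beta>) - q\<close> multiplies the leading coefficient by \<open>l - 1\<close> and
  preserves the degree, hence it is onto.\<close>

lemma poly_homological_equation:
  fixes l \<beta> :: complex
  assumes "l \<noteq> 1"
  shows "\<exists>q. \<forall>\<zeta>. l * poly q (\<zeta> + \<beta>) - poly q \<zeta> = poly p \<zeta>"
proof -
  have "\<exists>q. smult l (pcompose q [:\<beta>, 1:]) - q = p" if "\<And>i. n \<le> i \<Longrightarrow> coeff p i = 0" for n
    using that
  proof (induction n arbitrary: p)
    case 0
    then have "p = 0" by (simp add: poly_eq_iff)
    then show ?case by (intro exI[of _ 0]) simp
  next
    case (Suc n)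
    \<comment> \<open>This monomial accounts for the coefficient of order \<open>n\<close>.\<close>
    define q where "q = monom (coeff p n / (l - 1)) n"
    define r where "r = smult l (pcompose q [:\<beta>, 1:]) - q"
    have comp: "pcompose q [:\<beta>, 1:] = smult (coeff p n / (l - 1)) ([:\<beta>, 1:] ^ n)"
      unfolding q_def by (rule poly_eq_poly_eq_iff[THEN iffD1]) (simp add: fun_eq_iff poly_pcompose poly_monom)
    have high: "coeff ([:\<beta>, 1:] ^ n) i = 0" if "n < i" for i
      using that by (intro coeff_eq_0) (simp add: degree_linear_power)
    have "coeff r n = (l - 1) * (coeff p n / (l - 1))"
      unfolding r_def comp by (simp only: coeff_diff coeff_smult coeff_linear_power q_def coeff_monom)
        (simp add: left_diff_distrib diff_divide_distrib)
    then have r: "coeff r n = coeff p n" "\<And>i. n < i \<Longrightarrow> coeff r i = 0"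
      unfolding r_def comp using assms by (simp_all add: q_def high)
    have "coeff (p - r) i = 0" if "n \<le> i" for i
      using that r Suc.prems by (cases "i = n") auto
    from Suc.IH[OF this] obtain q' where "smult l (pcompose q' [:\<beta>, 1:]) - q' = p - r" by blast
    then have "smult l (pcompose (q + q') [:\<beta>, 1:]) - (q + q') = p"
      by (simp add: r_def pcompose_add smult_add_right algebra_simps)
    then show ?case by blast
  qed
  from this[of "Suc (degree p)"] obtain q where q: "smult l (pcompose q [:\<beta>, 1:]) - q = p"
    using coeff_eq_0[of p] by (auto simp: Suc_le_eq)
  have "l * poly q (\<zeta> + \<beta>) - poly q \<zeta> = poly p \<zeta>" for \<zeta>
    by (simp add: q[symmetric] poly_pcompose add.commute)
  then show ?thesis by blast
qed

context exponent_semigroup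
begin

text \<open>Solving \<open>T (\<zeta> + \<beta>) - T \<zeta> = - k \<zeta>\<close> term by term leaves an error in \<open>T \<circ> f\<close>. It comes from the
  exponentially small difference \<open>f \<zeta> - \<zeta> - \<beta>\<close>, and so its exponents are those of \<open>k\<close> increased by
  elements of \<open>S\<close>.\<close>

lemma homological_step:
  assumes g: "has_exp_expansion C S (\<lambda>\<zeta>. f \<zeta> - \<zeta> - \<beta>)" and \<beta>: "Re \<beta> > 0"
    and k: "expsum U k" and U: "U \<subseteq> S"
  shows "\<exists>T. expsum U T \<and>
    has_exp_expansion C {u + s |u s. u \<in> U \<and> s \<in> S} (\<lambda>\<zeta>. k \<zeta> + T (f \<zeta>) - T \<zeta>)"
    (is "\<exists>T. _ \<and> has_exp_expansion C ?V _")
  using k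
proof (induction rule: expsum.induct)
  case zero
  show ?case
    using expsum.zero expsum_has_exp_expansion[OF expsum.zero] by (intro exI[of _ "\<lambda>_. 0"]) auto
next
  case (add_term s k p)
  then obtain T where T: "expsum U T" "has_exp_expansion C ?V (\<lambda>\<zeta>. k \<zeta> + T (f \<zeta>) - T \<zeta>)"
    by blast
  have "s > 0" using add_term(1) U exponent_ge[of s] \<delta>_pos by auto
  then have "norm (decay s \<beta>) \<noteq> 1" using \<beta> by (simp add: norm_exp)
  then have "decay s \<beta> \<noteq> 1" by (metis norm_one)
  then obtain q where q: "\<And>\<zeta>. decay s \<beta> * poly q (\<zeta> + \<beta>) - poly q \<zeta> = poly (- p) \<zeta>"
    using poly_homological_equation by blast
  define g where "g \<zeta> = f \<zeta> - \<zeta> - \<beta>" for \<zeta>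
  have g': "has_exp_expansion C S g" using assms(1) by (simp add: g_def[abs_def])
  \<comment> \<open>The error of the new term, up to the factor \<open>exp (- s \<beta>) exp (- s \<zeta>)\<close>\<close>
  define e where "e \<zeta> = poly q (\<zeta> + \<beta> + g \<zeta>) * exp (- of_real s * g \<zeta>) - poly q (\<zeta> + \<beta>)" for \<zeta>
  have lin: "has_exp_expansion C (insert 0 S) (\<lambda>\<zeta>. \<zeta> + \<beta>)"
  proof -
    have "poly [:\<beta>, 1:] = (\<lambda>\<zeta>. \<zeta> + \<beta>)" by auto
    then show ?thesis using expansion_poly[of "[:\<beta>, 1:]"] by metis
  qed
  have e: "has_exp_expansion C S e"
  proof -
    have "has_exp_expansion C (insert 0 S) (\<lambda>\<zeta>. \<zeta> + \<beta> + g \<zeta>)"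
      using has_exp_expansion_add[OF lin has_exp_expansion_mono[OF g']] by blast
    from has_exp_expansion_add[OF expansion_poly_perturb[OF lin g', of q]
        expansion_mult_ideal[OF expansion_exp[OF g', of "- of_real s"]
          expansion_poly_compose[OF this, of q]]]
    show ?thesis unfolding e_def[abs_def] by (simp add: algebra_simps)
  qed
  have "has_exp_expansion C ?V (\<lambda>\<zeta>. poly [:decay s \<beta>:] \<zeta> * decay s \<zeta> * e \<zeta>)"
  proof (rule has_exp_expansion_mult[OF C_pos expsum_has_exp_expansion[OF expsum_term] e, of s "{s}" _ "0"])
    show "t + u \<in> ?V" if "t \<in> {s}" "u \<in> S" for t u
      using that add_term(1) by blast
  qed (use \<open>s > 0\<close> \<delta>_pos in \<open>auto dest: exponent_ge\<close>)
  from has_exp_expansion_add[OF this T(2)]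
  have err: "has_exp_expansion C ?V (\<lambda>\<zeta>. decay s \<beta> * decay s \<zeta> * e \<zeta> + (k \<zeta> + T (f \<zeta>) - T \<zeta>))"
    by simp
  have err_eq: "decay s \<beta> * decay s \<zeta> * e \<zeta> + (k \<zeta> + T (f \<zeta>) - T \<zeta>) =
      poly p \<zeta> * decay s \<zeta> + k \<zeta> + (poly q (f \<zeta>) * decay s (f \<zeta>) + T (f \<zeta>)) -
      (poly q \<zeta> * decay s \<zeta> + T \<zeta>)" for \<zeta>
  proof -
    have f: "f \<zeta> = \<zeta> + \<beta> + g \<zeta>" by (simp add: g_def)
    have d: "decay s (f \<zeta>) = decay s \<beta> * decay s \<zeta> * exp (- of_real s * g \<zeta>)"
      unfolding f by (simp add: exp_add[symmetric] algebra_simps)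
    have p: "poly p \<zeta> = poly q \<zeta> - decay s \<beta> * poly q (\<zeta> + \<beta>)"
      using q[of \<zeta>] by (simp add: algebra_simps)
    show ?thesis unfolding e_def f[symmetric] d p by (simp add: algebra_simps)
  qed
  show ?case
    using expsum.add_term[OF add_term(1) T(1), of q] err[unfolded err_eq] by (intro exI) (rule conjI)
qed

text \<open>Each application of the previous lemma raises the exponents of the error by at least \<open>\<delta>\<close>, so
  that finitely many of them reach any given order.\<close>

lemma homological_approx:
  assumes g: "has_exp_expansion C S (\<lambda>\<zeta>. f \<zeta> - \<zeta> - \<beta>)" and \<beta>: "Re \<beta> > 0"
    and h: "has_exp_expansion C S h"
  shows "\<exists>T. expsum S T \<and> (\<lambda>\<zeta>. h \<zeta> + T (f \<zeta>) - T \<zeta>) \<in> O[Re_at_top_in C](decay \<nu>)"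
proof -
  have iter: "\<exists>T. expsum S T \<and> (\<lambda>\<zeta>. h \<zeta> + T (f \<zeta>) - T \<zeta>) \<in> O[Re_at_top_in C](decay \<nu>)"
    if "has_exp_expansion C {s \<in> S. \<nu> - real m * \<delta> < s} h" for m h
    using that
  proof (induction m arbitrary: h)
    case 0
    then have "h \<in> O[Re_at_top_in C](decay \<nu>)"
      by (intro has_exp_expansion_bigo[OF C_pos]) auto
    then show ?case using expsum.zero by (intro exI[of _ "\<lambda>_. 0"]) auto
  next
    case (Suc m)
    let ?U = "{s \<in> S. \<nu> - real (Suc m) * \<delta> < s}"
    let ?W = "{s \<in> S. \<nu> - real m * \<delta> < s}"
    obtain k where k: "expsum ?U k" "(\<lambda>\<zeta>. h \<zeta> - k \<zeta>) \<in> O[Re_at_top_in C](decay \<nu>)"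
      using Suc.prems by (rule has_exp_expansionE)
    obtain T where T: "expsum ?U T"
      "has_exp_expansion C {u + s |u s. u \<in> ?U \<and> s \<in> S} (\<lambda>\<zeta>. k \<zeta> + T (f \<zeta>) - T \<zeta>)"
      using homological_step[OF g \<beta> k(1)] by auto
    have "{u + s |u s. u \<in> ?U \<and> s \<in> S} \<subseteq> ?W"
    proof clarify
      fix u s assume "u \<in> S" "\<nu> - real (Suc m) * \<delta> < u" "s \<in> S"
      moreover have "real (Suc m) * \<delta> = real m * \<delta> + \<delta>" by (simp add: algebra_simps)
      ultimately show "u + s \<in> S \<and> \<nu> - real m * \<delta> < u + s"
        using exponent_ge[of s] exponent_add[of u s] by auto
    qed
    from Suc.IH[OF has_exp_expansion_mono[OF T(2) this]] obtain T' where T': "expsum S T'"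
      "(\<lambda>\<zeta>. k \<zeta> + T (f \<zeta>) - T \<zeta> + T' (f \<zeta>) - T' \<zeta>) \<in> O[Re_at_top_in C](decay \<nu>)"
      by blast
    have "expsum S (\<lambda>\<zeta>. T \<zeta> + T' \<zeta>)"
      using expsum_mono[OF T(1)] T'(1) by (intro expsum_add) auto
    moreover have "(\<lambda>\<zeta>. h \<zeta> + (T (f \<zeta>) + T' (f \<zeta>)) - (T \<zeta> + T' \<zeta>)) \<in> O[Re_at_top_in C](decay \<nu>)"
      using sum_in_bigo(1)[OF k(2) T'(2)] by (simp add: algebra_simps)
    ultimately show ?case by blast
  qed
  obtain m :: nat where "\<nu> / \<delta> < real m" using reals_Archimedean2 by blast
  then have "\<nu> < real m * \<delta>" using \<delta>_pos by (simp add: pos_divide_less_eq)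
  then have "S \<subseteq> {s \<in> S. \<nu> - real m * \<delta> < s}"
    using \<delta>_pos exponent_ge by force
  from iter[OF has_exp_expansion_mono[OF h this]] show ?thesis .
qed

end

section \<open>Uniqueness of coefficients\<close>

text \<open>The partial sum with \<open>N\<close> terms of the exponential series with exponents \<open>b\<close> and coefficients \<open>P\<close>\<close>

definition exp_partial_sum ::
    "(nat \<Rightarrow> real) \<Rightarrow> (nat \<Rightarrow> complex poly) \<Rightarrow> nat \<Rightarrow> complex \<Rightarrow> complex" where
  "exp_partial_sum b P N \<zeta> = (\<Sum>i<N. poly (P i) \<zeta> * decay (b i) \<zeta>)"

lemma expsum_exp_partial_sum:
  "(\<And>i. i < N \<Longrightarrow> b i \<in> T) \<Longrightarrow> expsum T (exp_partial_sum b P N)"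
  unfolding exp_partial_sum_def by (intro expsum_sum expsum_term) auto

lemma expsum_range_imp_partial_sum:
  assumes "expsum (range b) k"
  shows "\<exists>P N. \<forall>n\<ge>N. k = exp_partial_sum b P n"
  using assms
proof (induction rule: expsum.induct)
  case zero
  show ?case by (intro exI[of _ "\<lambda>_. 0"]) (simp add: exp_partial_sum_def fun_eq_iff)
next
  case (add_term s k p)
  obtain j where s: "s = b j" using add_term(1) by blast
  obtain P N where k: "\<And>n. n \<ge> N \<Longrightarrow> k = exp_partial_sum b P n" using add_term.IH by blast
  have "(\<lambda>\<zeta>. poly p \<zeta> * decay s \<zeta> + k \<zeta>) = exp_partial_sum b (P(j := p + P j)) n"
    if "n \<ge> max N (Suc j)" for n
  proof
    fix \<zeta>
    have "exp_partial_sum b (P(j := p + P j)) n \<zeta> =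
        (\<Sum>i<n. (if i = j then poly p \<zeta> * decay (b i) \<zeta> else 0) + poly (P i) \<zeta> * decay (b i) \<zeta>)"
      unfolding exp_partial_sum_def by (intro sum.cong) (auto simp: distrib_right)
    also have "\<dots> = poly p \<zeta> * decay (b j) \<zeta> + exp_partial_sum b P n \<zeta>"
      using that by (simp add: sum.distrib exp_partial_sum_def)
    finally show "poly p \<zeta> * decay s \<zeta> + k \<zeta> = exp_partial_sum b (P(j := p + P j)) n \<zeta>"
      using k[of n] that s by simp
  qed
  then show ?case by blast
qed

text \<open>Coefficients of terms that are larger than a sum's order of decay vanish: the first nonzero one
  would be a polynomial tending to 0 at infinity.\<close>

lemma exp_partial_sum_coeffs_0:
  assumes C: "C > 0" and b: "strict_mono b"
    and small: "exp_partial_sum b P N \<in> O[Re_at_top_in C](decay \<nu>)"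
    and "i < N" "b i < \<nu>"
  shows "P i = 0"
  using assms(4,5)
proof (induction i rule: less_induct)
  case (less i)
  let ?rest = "\<lambda>\<zeta>. \<Sum>j\<in>{i<..<N}. poly (P j) \<zeta> * decay (b j) \<zeta>"
  have b_less: "b i < b j" if "i < j" for j using b that by (rule strict_monoD)
  \<comment> \<open>An order strictly between the term \<open>i\<close> and all that follows, including the error\<close>
  define \<mu> where "\<mu> = (b i + min \<nu> (b (Suc i))) / 2"
  have \<mu>: "b i < \<mu>" "\<mu> \<le> \<nu>" "\<mu> < b (Suc i)"
    using less.prems b_less[of "Suc i"] by (auto simp: \<mu>_def min_def)
  have split: "exp_partial_sum b P N \<zeta> = poly (P i) \<zeta> * decay (b i) \<zeta> + ?rest \<zeta>" for \<zeta>
  proof -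
    have "P j = 0" if "j < i" for j
      using less.IH[of j] less.prems strict_monoD[OF b that] that by simp
    then have "exp_partial_sum b P N \<zeta> = (\<Sum>j\<in>{i..<N}. poly (P j) \<zeta> * decay (b j) \<zeta>)"
      unfolding exp_partial_sum_def by (intro sum.mono_neutral_right) (auto simp: not_le)
    also have "{i..<N} = insert i {i<..<N}" using less.prems by auto
    finally show ?thesis by simp
  qed
  have "\<mu> < b j" if "i < j" for j
    using \<mu>(3) strict_mono_less_eq[OF b, of "Suc i" j] that by simp
  then have "?rest \<in> O[Re_at_top_in C](decay \<mu>)"
    by (intro big_sum_in_bigo term_bigo_decay C) auto
  from sum_in_bigo(2)[OF bigo_decay_mono[OF small \<mu>(2)] this]
  have "(\<lambda>\<zeta>. poly (P i) \<zeta> * decay (b i) \<zeta>) \<in> O[Re_at_top_in C](decay \<mu>)"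
    by (simp add: split)
  from bigo_decay_mult[OF this, of "decay (- b i)" "- b i" "\<mu> - b i"]
  have "(\<lambda>\<zeta>. poly (P i) \<zeta> * decay (b i) \<zeta> * decay (- b i) \<zeta>) \<in> O[Re_at_top_in C](decay (\<mu> - b i))"
    by simp
  then have "poly (P i) \<in> O[Re_at_top_in C](decay (\<mu> - b i))"
    unfolding mult.assoc decay_mult by simp
  then have "(poly (P i) \<longlongrightarrow> 0) (Re_at_top_in C)"
    by (rule bigo_decay_tendsto_0) (use \<mu> in simp)
  then show "P i = 0" by (rule poly_tendsto_0_imp_0[OF C])
qed

text \<open>The approximating sums of different orders agree in their coefficients, and hence are partial sums
  of a single series up to terms beyond the order.\<close>

lemma has_exp_expansion_imp_series:
  assumes C: "C > 0" and b: "strict_mono b" and lim: "filterlim b at_top sequentially"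
    and h: "has_exp_expansion C (range b) h"
  shows "\<exists>P. \<forall>\<nu>. \<exists>N. (\<lambda>\<zeta>. h \<zeta> - exp_partial_sum b P N \<zeta>) \<in> o[Re_at_top_in C](decay \<nu>)"
proof -
  have "\<exists>P N. \<forall>n\<ge>N. (\<lambda>\<zeta>. h \<zeta> - exp_partial_sum b P n \<zeta>) \<in> O[Re_at_top_in C](decay (real m))" for m
  proof -
    obtain k where k: "expsum (range b) k" "(\<lambda>\<zeta>. h \<zeta> - k \<zeta>) \<in> O[Re_at_top_in C](decay (real m))"
      using h by (rule has_exp_expansionE)
    with expsum_range_imp_partial_sum[OF k(1)] show ?thesis by metis
  qed
  then obtain Q M where Q: "\<And>m n. n \<ge> M m \<Longrightarrow>
      (\<lambda>\<zeta>. h \<zeta> - exp_partial_sum b (Q m) n \<zeta>) \<in> O[Re_at_top_in C](decay (real m))"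
    by metis
  have agree: "Q m i = Q m' i" if "b i < real m" "m \<le> m'" for m m' i
  proof -
    define n where "n = max (Suc i) (max (M m) (M m'))"
    have "(\<lambda>\<zeta>. (h \<zeta> - exp_partial_sum b (Q m') n \<zeta>) - (h \<zeta> - exp_partial_sum b (Q m) n \<zeta>))
        \<in> O[Re_at_top_in C](decay (real m))"
      using that by (intro sum_in_bigo bigo_decay_mono[OF Q[of m' n], of "real m"] Q[of m n]) (auto simp: n_def)
    moreover have "(\<lambda>\<zeta>. (h \<zeta> - exp_partial_sum b (Q m') n \<zeta>) - (h \<zeta> - exp_partial_sum b (Q m) n \<zeta>)) =
        exp_partial_sum b (\<lambda>i. Q m i - Q m' i) n"
      by (simp add: fun_eq_iff exp_partial_sum_def left_diff_distrib sum_subtractf)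
    ultimately have "exp_partial_sum b (\<lambda>i. Q m i - Q m' i) n \<in> O[Re_at_top_in C](decay (real m))"
      by simp
    then have "Q m i - Q m' i = 0"
      by (rule exp_partial_sum_coeffs_0[OF C b _ _ that(1)]) (simp add: n_def)
    then show ?thesis by simp
  qed
  \<comment> \<open>The coefficient \<open>i\<close> is read off from an approximation of some order \<open>c i\<close> beyond \<open>b i\<close>.\<close>
  define c where "c i = Suc (nat \<lceil>b i\<rceil>)" for i
  have c: "b i < real (c i)" for i unfolding c_def by linarith
  define P where "P i = Q (c i) i" for i
  have P: "P i = Q m i" if "b i < real m" for i m
    using agree[OF that, of "c i"] agree[OF c[of i], of m] unfolding P_def by (metis linear)
  have "\<exists>N. (\<lambda>\<zeta>. h \<zeta> - exp_partial_sum b P N \<zeta>) \<in> o[Re_at_top_in C](decay \<nu>)" for \<nu>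
  proof -
    obtain m :: nat where m: "\<nu> < real m" using reals_Archimedean2 by blast
    define \<mu> where "\<mu> = (\<nu> + real m) / 2"
    have \<mu>: "\<nu> < \<mu>" "\<mu> < real m" using m by (auto simp: \<mu>_def)
    have "(\<lambda>\<zeta>. (h \<zeta> - exp_partial_sum b (Q m) (M m) \<zeta>) +
        exp_partial_sum b (\<lambda>i. Q m i - P i) (M m) \<zeta>) \<in> O[Re_at_top_in C](decay \<mu>)"
    proof (rule sum_in_bigo)
      show "(\<lambda>\<zeta>. h \<zeta> - exp_partial_sum b (Q m) (M m) \<zeta>) \<in> O[Re_at_top_in C](decay \<mu>)"
        by (rule bigo_decay_mono[OF Q]) (use \<mu> in auto)
      have "(\<lambda>\<zeta>. poly (Q m i - P i) \<zeta> * decay (b i) \<zeta>) \<in> O[Re_at_top_in C](decay \<mu>)" for i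
      proof (cases "b i < real m")
        case True
        then show ?thesis by (simp add: P)
      next
        case False
        then show ?thesis using \<mu> by (intro term_bigo_decay C) auto
      qed
      then show "exp_partial_sum b (\<lambda>i. Q m i - P i) (M m) \<in> O[Re_at_top_in C](decay \<mu>)"
        unfolding exp_partial_sum_def by (intro big_sum_in_bigo)
    qed
    moreover have "(\<lambda>\<zeta>. (h \<zeta> - exp_partial_sum b (Q m) (M m) \<zeta>) +
        exp_partial_sum b (\<lambda>i. Q m i - P i) (M m) \<zeta>) = (\<lambda>\<zeta>. h \<zeta> - exp_partial_sum b P (M m) \<zeta>)"
      by (simp add: fun_eq_iff exp_partial_sum_def left_diff_distrib sum_subtractf)
    ultimately have "(\<lambda>\<zeta>. h \<zeta> - exp_partial_sum b P (M m) \<zeta>) \<in> O[Re_at_top_in C](decay \<mu>)"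
      by simp
    then show ?thesis using bigo_decay_imp_smallo \<mu>(1) by blast
  qed
  then show ?thesis by blast
qed

section \<open>Finitely generated semigroups of exponents\<close>

lemma subsemigroup_gen_cases:
  assumes "s \<in> subsemigroup_gen G"
  shows "s \<in> G \<or> (\<exists>g\<in>G. \<exists>t\<in>subsemigroup_gen G. s = g + t)"
  using assms
proof (induction rule: subsemigroup_gen.induct)
  case (add x y)
  from add.IH(1) show ?case
  proof
    assume "\<exists>g\<in>G. \<exists>t\<in>subsemigroup_gen G. x = g + t"
    then obtain g t where "g \<in> G" "t \<in> subsemigroup_gen G" "x = g + t" by blast
    then show ?thesis
      using add.hyps(2) by (intro disjI2 bexI[of _ g] bexI[of _ "t + y"]) (auto intro: subsemigroup_gen.add)
  qed (use add in blast)
qed blast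

lemma subsemigroup_gen_ge:
  "s \<in> subsemigroup_gen G \<Longrightarrow> (\<And>g. g \<in> G \<Longrightarrow> \<delta> \<le> g) \<Longrightarrow> \<delta> > 0 \<Longrightarrow> \<delta> \<le> s"
  by (induction rule: subsemigroup_gen.induct) force+

lemma finite_subsemigroup_gen_below:
  assumes "finite G" "\<And>g. g \<in> G \<Longrightarrow> \<delta> \<le> g" "\<delta> > 0"
  shows "finite {s \<in> subsemigroup_gen G. s < x}"
proof -
  have fin: "finite {s \<in> subsemigroup_gen G. s < real n * \<delta>}" for n
  proof (induction n)
    case 0
    have "{s \<in> subsemigroup_gen G. s < real 0 * \<delta>} = {}"
      using subsemigroup_gen_ge[OF _ assms(2,3)] assms(3) by force
    then show ?case by (simp only: finite.emptyI)
  next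
    case (Suc n)
    have "{s \<in> subsemigroup_gen G. s < real (Suc n) * \<delta>} \<subseteq>
        G \<union> (\<Union>g\<in>G. (\<lambda>t. g + t) ` {s \<in> subsemigroup_gen G. s < real n * \<delta>})"
    proof
      fix s assume s: "s \<in> {s \<in> subsemigroup_gen G. s < real (Suc n) * \<delta>}"
      then consider "s \<in> G" | g t where "g \<in> G" "t \<in> subsemigroup_gen G" "s = g + t"
        using subsemigroup_gen_cases by blast
      then show "s \<in> G \<union> (\<Union>g\<in>G. (\<lambda>t. g + t) ` {s \<in> subsemigroup_gen G. s < real n * \<delta>})"
      proof cases
        case 2
        then have "t < real n * \<delta>" using s assms(2)[of g] by (simp add: algebra_simps)
        then show ?thesis using 2 by blast
      qed blast
    qed
    then show ?case by (rule finite_subset) (use Suc assms(1) in auto)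
  qed
  obtain n :: nat where "x / \<delta> < real n" using reals_Archimedean2 by blast
  then have "x < real n * \<delta>" using assms(3) by (simp add: pos_divide_less_eq)
  then show ?thesis by (intro finite_subset[OF _ fin[of n]]) auto
qed

text \<open>The enumeration is inverse to the rank function, which counts the smaller elements.\<close>

lemma locally_finite_enumeration:
  fixes S :: "real set"
  assumes fin: "\<And>x. finite {s \<in> S. s < x}" and "infinite S"
  shows "\<exists>b. strict_mono b \<and> range b = S \<and> filterlim b at_top sequentially"
proof -
  define r where "r x = card {s \<in> S. s < x}" for x
  have r_less: "r x < r y" if "x \<in> S" "x < y" for x y
    unfolding r_def using that by (intro psubset_card_mono fin) auto
  have inj: "inj_on r S"
    by (rule inj_onI) (metis r_less less_irrefl linorder_neqE_linordered_idom)
  have down: "\<exists>y\<in>S. r y = m" if "x \<in> S" "m \<le> r x" for x m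
    using that
  proof (induction "r x" arbitrary: x rule: less_induct)
    case less
    show ?case
    proof (cases "m = r x")
      case False
      let ?B = "{s \<in> S. s < x}"
      have "card ?B > 0" using False less.prems by (simp add: r_def)
      then have ne: "?B \<noteq> {}" by (metis card.empty less_irrefl)
      define y where "y = Max ?B"
      have y: "y \<in> S" "y < x" and max: "\<And>s. s \<in> ?B \<Longrightarrow> s \<le> y"
        using Max_in[OF fin ne] Max_ge[OF fin] by (auto simp: y_def)
      have "?B = insert y {s \<in> S. s < y}" using y max by force
      then have "r x = Suc (r y)" using fin[of y] by (simp add: r_def)
      then show ?thesis using less.hyps[of y] r_less[OF y] y False less.prems by simp
    qed (use less in blast)
  qed
  have surj: "\<exists>y\<in>S. r y = m" for m
  proof (rule ccontr)
    assume "\<not> (\<exists>y\<in>S. r y = m)"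
    then have "r ` S \<subseteq> {..<m}" using down by (auto simp: not_less[symmetric])
    then show False using finite_imageD[OF finite_subset inj] \<open>infinite S\<close> by blast
  qed
  define b where "b = the_inv_into S r"
  have b: "b m \<in> S" "r (b m) = m" for m
    using surj[of m] the_inv_into_into[OF inj, of m S] f_the_inv_into_f[OF inj, of m]
    unfolding b_def by auto
  have mono: "strict_mono b"
    by (rule strict_monoI) (metis b less_asym linorder_neqE_linordered_idom r_less)
  have range: "range b = S"
    using b the_inv_into_f_f[OF inj] unfolding b_def by (metis image_eqI subsetI subset_antisym UNIV_I imageE)
  have "filterlim b at_top sequentially"
    unfolding filterlim_at_top
  proof
    fix Z
    have "Z \<le> b n" if "n \<ge> r Z" for n
      using r_less[of "b n" Z] b[of n] that by force
    then show "\<forall>\<^sub>F n in sequentially. Z \<le> b n"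
      unfolding eventually_sequentially by blast
  qed
  with mono range show ?thesis by blast
qed

section \<open>Attracting maps and the Fatou coordinate\<close>

lemma quadratic_germ_mono: "Y \<le> Z \<Longrightarrow> quadratic_germ C Z \<subseteq> quadratic_germ C Y"
  by (auto simp: quadratic_germ_def)

text \<open>The quantitative content of hyperbolicity far to the right: \<open>f\<close> moves points to the right at a
  definite speed without leaving the domain, and is exponentially close to a translation.\<close>

locale attracting_map =
  fixes C X \<eta> \<epsilon> M :: real and \<beta> :: complex and f :: "complex \<Rightarrow> complex"
  assumes C_pos: "C > 0" and \<eta>_pos: "\<eta> > 0" and \<epsilon>_pos: "\<epsilon> > 0" and M_nonneg: "M \<ge> 0"
    and holomorphic: "f holomorphic_on quadratic_germ C X"
    and maps_to_domain: "w \<in> quadratic_germ C X \<Longrightarrow> f w \<in> quadratic_domain C"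
    and moves_right: "w \<in> quadratic_germ C X \<Longrightarrow> Re w + \<eta> \<le> Re (f w)"
    and near_translation:
      "w \<in> quadratic_germ C X \<Longrightarrow> norm (f w - w - \<beta>) \<le> M * exp (- \<epsilon> * Re w)"
begin

text \<open>The interior of \<open>quadratic_germ C X\<close>, on which holomorphy can be tested locally\<close>

definition region :: "complex set" where
  "region = {w \<in> quadratic_domain C. X < Re w}"

text \<open>The Fatou coordinate is the limit of \<open>(f ^^ n) w - n * \<beta>\<close>, written as \<open>w + correction w\<close> with
  a telescoping series.\<close>

definition correction :: "complex \<Rightarrow> complex" where
  "correction w = (\<Sum>n. f ((f ^^ n) w) - (f ^^ n) w - \<beta>)"

lemma region_subset_germ: "region \<subseteq> quadratic_germ C X"
  by (auto simp: region_def quadratic_germ_def)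

lemma open_region: "open region"
proof -
  have "region = quadratic_domain C \<inter> {w. X < Re w}" by (auto simp: region_def)
  then show ?thesis
    using open_quadratic_domain[OF C_pos] by (simp add: open_Int open_halfspace_Re_gt)
qed

lemma invariant:
  assumes "X \<le> Y" "w \<in> quadratic_germ C Y"
  shows "f w \<in> quadratic_germ C Y"
proof -
  have "w \<in> quadratic_germ C X" using assms quadratic_germ_mono by blast
  from maps_to_domain[OF this] moves_right[OF this] show ?thesis
    using assms \<eta>_pos by (auto simp: quadratic_germ_def)
qed

lemma orbit:
  assumes "X \<le> Y" "w \<in> quadratic_germ C Y"
  shows "(f ^^ n) w \<in> quadratic_germ C Y \<and> Re w + real n * \<eta> \<le> Re ((f ^^ n) w)"
proof (induction n)
  case (Suc n)
  have "(f ^^ n) w \<in> quadratic_germ C X" using Suc quadratic_germ_mono[OF assms(1)] by blast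
  from moves_right[OF this] show ?case
    using Suc invariant[OF assms(1)] by (auto simp: algebra_simps)
qed (use assms in simp)

lemma orbit_tendsto:
  assumes w: "w \<in> quadratic_germ C X" and r: "(r \<longlongrightarrow> l) (Re_at_top_in C)"
  shows "(\<lambda>n. r ((f ^^ n) w)) \<longlonglongrightarrow> l"
proof (rule filterlim_compose[OF r], unfold filterlim_iff eventually_Re_at_top_in, safe)
  fix P Y assume P: "\<forall>\<zeta>\<in>quadratic_domain C. Y \<le> Re \<zeta> \<longrightarrow> P \<zeta>"
  obtain N :: nat where "(Y - Re w) / \<eta> < real N" using reals_Archimedean2 by blast
  then have N: "Y - Re w < real N * \<eta>" using \<eta>_pos by (simp add: pos_divide_less_eq)
  have "P ((f ^^ n) w)" if "n \<ge> N" for n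
  proof -
    have "real N * \<eta> \<le> real n * \<eta>" using that \<eta>_pos by (intro mult_right_mono) auto
    then show ?thesis using N P orbit[OF order_refl w, of n] by (auto simp: quadratic_germ_def)
  qed
  then show "\<forall>\<^sub>F n in sequentially. P ((f ^^ n) w)"
    unfolding eventually_sequentially by blast
qed

text \<open>Sums of an exponentially small function along an orbit are dominated by a geometric series.\<close>

lemma orbit_decay:
  assumes "X \<le> Y" "w \<in> quadratic_germ C Y" "\<nu> > 0" "K \<ge> 0"
    and e: "\<And>z. z \<in> quadratic_germ C Y \<Longrightarrow> norm (e z) \<le> K * exp (- \<nu> * Re z)"
  shows "norm (e ((f ^^ n) w)) \<le> K * exp (- \<nu> * Re w) * exp (- \<nu> * \<eta>) ^ n"
proof -
  have o: "(f ^^ n) w \<in> quadratic_germ C Y" "Re w + real n * \<eta> \<le> Re ((f ^^ n) w)"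
    using orbit[OF assms(1,2)] by auto
  have "norm (e ((f ^^ n) w)) \<le> K * exp (- \<nu> * Re ((f ^^ n) w))" by (rule e[OF o(1)])
  also have "\<dots> \<le> K * exp (- \<nu> * (Re w + real n * \<eta>))"
    using o(2) assms(3,4) by (intro mult_left_mono) auto
  also have "\<dots> = K * exp (- \<nu> * Re w) * exp (- \<nu> * \<eta>) ^ n"
    by (simp add: exp_of_nat_mult[symmetric] exp_add[symmetric] algebra_simps)
  finally show ?thesis .
qed

lemma displacement_bound:
  assumes "w \<in> quadratic_germ C X"
  shows "norm (f ((f ^^ n) w) - (f ^^ n) w - \<beta>) \<le> M * exp (- \<epsilon> * Re w) * exp (- \<epsilon> * \<eta>) ^ n"
  using orbit_decay[OF order_refl assms \<epsilon>_pos M_nonneg, of "\<lambda>z. f z - z - \<beta>"] near_translation by simp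

lemma ratio_less_1: "\<nu> > 0 \<Longrightarrow> exp (- \<nu> * \<eta>) < 1"
  using \<eta>_pos by simp

lemma summable_displacement:
  assumes "w \<in> quadratic_germ C X"
  shows "summable (\<lambda>n. f ((f ^^ n) w) - (f ^^ n) w - \<beta>)"
  by (rule summable_comparison_test'[OF summable_mult[OF summable_geometric] displacement_bound[OF assms]])
    (use ratio_less_1[OF \<epsilon>_pos] in auto)

lemma norm_correction_le:
  assumes "w \<in> quadratic_germ C X"
  shows "norm (correction w) \<le> M * exp (- \<epsilon> * Re w) / (1 - exp (- \<epsilon> * \<eta>))"
proof -
  have q: "norm (exp (- \<epsilon> * \<eta>)) < 1" using ratio_less_1[OF \<epsilon>_pos] by simp
  have "norm (correction w) \<le> (\<Sum>n. M * exp (- \<epsilon> * Re w) * exp (- \<epsilon> * \<eta>) ^ n)"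
    unfolding correction_def
    by (rule norm_suminf_le[OF displacement_bound[OF assms] summable_mult[OF summable_geometric[OF q]]])
  also have "\<dots> = M * exp (- \<epsilon> * Re w) / (1 - exp (- \<epsilon> * \<eta>))"
    using suminf_mult[OF summable_geometric[OF q]] suminf_geometric[OF q] by simp
  finally show ?thesis .
qed

lemma correction_tendsto_0: "(correction \<longlongrightarrow> 0) (Re_at_top_in C)"
proof (rule bigo_decay_tendsto_0[OF bigoI \<epsilon>_pos])
  show "\<forall>\<^sub>F w in Re_at_top_in C.
      norm (correction w) \<le> M / (1 - exp (- \<epsilon> * \<eta>)) * norm (decay \<epsilon> w)"
    unfolding eventually_Re_at_top_in
    by (rule exI[of _ X]) (use norm_correction_le in \<open>auto simp: quadratic_germ_def norm_exp\<close>)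
qed

lemma correction_comp:
  assumes "w \<in> quadratic_germ C X"
  shows "correction w = correction (f w) + (f w - w - \<beta>)"
proof -
  have "correction (f w) = (\<Sum>n. f ((f ^^ Suc n) w) - (f ^^ Suc n) w - \<beta>)"
    unfolding correction_def by (simp add: funpow_swap1)
  also have "\<dots> = correction w - (f w - w - \<beta>)"
    unfolding correction_def using suminf_split_head[OF summable_displacement[OF assms]] by simp
  finally show ?thesis by simp
qed

lemma holomorphic_correction: "correction holomorphic_on region"
proof (rule holomorphic_uniform_sequence[OF open_region])
  have f: "f holomorphic_on region"
    by (rule holomorphic_on_subset[OF holomorphic region_subset_germ])
  have into: "f ` region \<subseteq> region"
  proof
    fix z assume "z \<in> f ` region"
    then obtain w where w: "w \<in> region" "z = f w" by blast
    then have "w \<in> quadratic_germ C X" using region_subset_germ by blast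
    from maps_to_domain[OF this] moves_right[OF this] w \<eta>_pos show "z \<in> region"
      by (auto simp: region_def)
  qed
  have iter: "(f ^^ n) holomorphic_on region \<and> (f ^^ n) ` region \<subseteq> region" for n
  proof (induction n)
    case (Suc n)
    have "f \<circ> (f ^^ n) holomorphic_on region"
      using Suc by (intro holomorphic_on_compose_gen[OF _ f]) auto
    moreover have "(f ^^ Suc n) ` region \<subseteq> region" using Suc into by auto
    ultimately show ?case by (simp add: o_def)
  qed auto
  have fiter: "(\<lambda>w. f ((f ^^ n) w)) holomorphic_on region" for n
    using iter[of "Suc n"] unfolding funpow.simps comp_def by blast
  show "(\<lambda>w. \<Sum>i<n. f ((f ^^ i) w) - (f ^^ i) w - \<beta>) holomorphic_on region" for n
    using iter fiter by (intro holomorphic_intros) auto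
  have "uniform_limit region (\<lambda>n w. \<Sum>i<n. f ((f ^^ i) w) - (f ^^ i) w - \<beta>) correction sequentially"
    unfolding correction_def[abs_def]
  proof (rule Weierstrass_m_test)
    fix n w assume w: "w \<in> region"
    then have "w \<in> quadratic_germ C X" using region_subset_germ by blast
    from displacement_bound[OF this, of n]
    have "norm (f ((f ^^ n) w) - (f ^^ n) w - \<beta>) \<le> M * exp (- \<epsilon> * Re w) * exp (- \<epsilon> * \<eta>) ^ n" .
    also have "\<dots> \<le> M * exp (- \<epsilon> * X) * exp (- \<epsilon> * \<eta>) ^ n"
      using w \<epsilon>_pos M_nonneg by (intro mult_right_mono mult_left_mono) (auto simp: region_def)
    finally show "norm (f ((f ^^ n) w) - (f ^^ n) w - \<beta>) \<le> M * exp (- \<epsilon> * X) * exp (- \<epsilon> * \<eta>) ^ n" .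
  next
    show "summable (\<lambda>n. M * exp (- \<epsilon> * X) * exp (- \<epsilon> * \<eta>) ^ n)"
      using ratio_less_1[OF \<epsilon>_pos] by (intro summable_mult summable_geometric) simp
  qed
  note lim = this
  show "\<exists>d>0. cball w d \<subseteq> region \<and> uniform_limit (cball w d)
      (\<lambda>n w. \<Sum>i<n. f ((f ^^ i) w) - (f ^^ i) w - \<beta>) correction sequentially"
    if "w \<in> region" for w
  proof -
    have "\<exists>d>0. cball w d \<subseteq> region"
      using open_region that unfolding open_contains_cball by (rule bspec)
    then obtain d where d: "d > 0" "cball w d \<subseteq> region" by blast
    show ?thesis
      by (intro exI[of _ d] conjI d uniform_limit_on_subset[OF lim d(2)])
  qed
qed

text \<open>Uniqueness: the difference of two Fatou coordinates is constant along orbits and tends to 0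
  along them.\<close>

lemma invariant_function_eq_0:
  fixes r :: "complex \<Rightarrow> complex"
  assumes "X \<le> Y" and w: "w \<in> quadratic_germ C Y" and r: "(r \<longlongrightarrow> 0) (Re_at_top_in C)"
    and inv: "\<And>z. z \<in> quadratic_germ C Y \<Longrightarrow> r (f z) = r z"
  shows "r w = 0"
proof -
  have "r ((f ^^ n) w) = r w" for n
    using orbit[OF assms(1) w] by (induction n) (auto simp: inv)
  moreover have "(\<lambda>n. r ((f ^^ n) w)) \<longlonglongrightarrow> 0"
    using w quadratic_germ_mono[OF assms(1)] by (intro orbit_tendsto r) auto
  ultimately have "(\<lambda>n. r w) \<longlonglongrightarrow> 0" by simp
  from LIMSEQ_unique[OF tendsto_const this] show ?thesis .
qed

text \<open>A function that tends to 0 is recovered from its increments along orbits, and inherits their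
  order of decay.\<close>

lemma bigo_decay_from_increment:
  assumes r: "(r \<longlongrightarrow> 0) (Re_at_top_in C)" and \<nu>: "\<nu> > 0"
    and inc: "(\<lambda>w. r (f w) - r w) \<in> O[Re_at_top_in C](decay \<nu>)"
  shows "r \<in> O[Re_at_top_in C](decay \<nu>)"
proof -
  obtain K where K: "K > 0" "\<forall>\<^sub>F w in Re_at_top_in C. norm (r (f w) - r w) \<le> K * norm (decay \<nu> w)"
    using inc by (rule landau_o.bigE)
  then obtain Y0 where Y0:
    "\<And>w. w \<in> quadratic_domain C \<Longrightarrow> Y0 \<le> Re w \<Longrightarrow> norm (r (f w) - r w) \<le> K * exp (- \<nu> * Re w)"
    by (auto simp: eventually_Re_at_top_in norm_exp)
  define Y where "Y = max X Y0"
  have e: "norm (r (f w) - r w) \<le> K * exp (- \<nu> * Re w)" if "w \<in> quadratic_germ C Y" for w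
    using Y0 that by (auto simp: Y_def quadratic_germ_def)
  define q where "q = exp (- \<nu> * \<eta>)"
  have q: "norm q < 1" "q \<ge> 0" using ratio_less_1[OF \<nu>] by (auto simp: q_def)
  have bound: "norm (r w) \<le> K / (1 - q) * exp (- \<nu> * Re w)" if w: "w \<in> quadratic_germ C Y" for w
  proof -
    have "r ((f ^^ n) w) - r w = (\<Sum>i<n. r (f ((f ^^ i) w)) - r ((f ^^ i) w))" for n
      using sum_lessThan_telescope[of "\<lambda>i. r ((f ^^ i) w)" n] by simp
    then have telescope: "(\<lambda>n. r ((f ^^ n) w) - r w) =
        (\<lambda>n. \<Sum>i<n. r (f ((f ^^ i) w)) - r ((f ^^ i) w))" by blast
    have "(\<lambda>n. r ((f ^^ n) w)) \<longlonglongrightarrow> 0"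
      using w quadratic_germ_mono[of X Y] by (intro orbit_tendsto r) (auto simp: Y_def)
    then have "(\<lambda>n. r ((f ^^ n) w) - r w) \<longlonglongrightarrow> 0 - r w" by (intro tendsto_intros)
    then have "(\<lambda>i. r (f ((f ^^ i) w)) - r ((f ^^ i) w)) sums (- r w)"
      unfolding telescope sums_def by simp
    then have "norm (r w) = norm (\<Sum>i. r (f ((f ^^ i) w)) - r ((f ^^ i) w))"
      by (simp add: sums_iff)
    also have "\<dots> \<le> (\<Sum>i. K * exp (- \<nu> * Re w) * q ^ i)"
      using orbit_decay[OF _ w \<nu>, of K "\<lambda>z. r (f z) - r z"] K(1) e
      by (intro norm_suminf_le summable_mult summable_geometric q) (auto simp: q_def Y_def)
    also have "\<dots> = K / (1 - q) * exp (- \<nu> * Re w)"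
      using suminf_mult[OF summable_geometric[OF q(1)]] suminf_geometric[OF q(1)] by simp
    finally show ?thesis .
  qed
  show ?thesis
  proof (rule bigoI)
    show "\<forall>\<^sub>F w in Re_at_top_in C. norm (r w) \<le> K / (1 - q) * norm (decay \<nu> w)"
      unfolding eventually_Re_at_top_in using bound
      by (intro exI[of _ Y]) (auto simp: quadratic_germ_def norm_exp)
  qed
qed

lemma correction_has_exp_expansion:
  assumes "exponent_semigroup C S \<delta>" "has_exp_expansion C S (\<lambda>\<zeta>. f \<zeta> - \<zeta> - \<beta>)" "Re \<beta> > 0"
  shows "has_exp_expansion C S correction"
  unfolding has_exp_expansion_def
proof
  interpret exponent_semigroup C S \<delta> by fact
  fix \<mu> :: real
  define \<nu> where "\<nu> = max \<mu> 1"
  obtain T where T: "expsum S T"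
    "(\<lambda>\<zeta>. (f \<zeta> - \<zeta> - \<beta>) + T (f \<zeta>) - T \<zeta>) \<in> O[Re_at_top_in C](decay \<nu>)"
    using homological_approx[OF assms(2,3,2)] by blast
  have ev: "\<forall>\<^sub>F \<zeta> in Re_at_top_in C. (correction (f \<zeta>) - T (f \<zeta>)) - (correction \<zeta> - T \<zeta>) =
      - ((f \<zeta> - \<zeta> - \<beta>) + T (f \<zeta>) - T \<zeta>)"
    unfolding eventually_Re_at_top_in using correction_comp
    by (intro exI[of _ X]) (auto simp: quadratic_germ_def algebra_simps)
  have inc: "(\<lambda>\<zeta>. (correction (f \<zeta>) - T (f \<zeta>)) - (correction \<zeta> - T \<zeta>)) \<in> O[Re_at_top_in C](decay \<nu>)"
    using T(2) by (simp only: landau_o.big.in_cong[OF ev] landau_o.big.uminus_in_iff)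
  have "(T \<longlongrightarrow> 0) (Re_at_top_in C)"
    using expansion_bigo[OF expsum_has_exp_expansion[OF T(1)], of "\<delta> / 2"] \<delta>_pos
    by (intro bigo_decay_tendsto_0[of T _ "\<delta> / 2"]) auto
  then have lim: "((\<lambda>\<zeta>. correction \<zeta> - T \<zeta>) \<longlongrightarrow> 0) (Re_at_top_in C)"
    using tendsto_diff[OF correction_tendsto_0] by force
  have "(\<lambda>\<zeta>. correction \<zeta> - T \<zeta>) \<in> O[Re_at_top_in C](decay \<nu>)"
    by (rule bigo_decay_from_increment[OF lim _ inc]) (simp add: \<nu>_def)
  then have "(\<lambda>\<zeta>. correction \<zeta> - T \<zeta>) \<in> O[Re_at_top_in C](decay \<mu>)"
    by (rule bigo_decay_mono) (simp add: \<nu>_def)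
  with T(1) show "\<exists>k. expsum S k \<and> (\<lambda>\<zeta>. correction \<zeta> - k \<zeta>) \<in> O[Re_at_top_in C](decay \<mu>)"
    by blast
qed

lemma correction_real:
  assumes "X \<le> Y" "w \<in> quadratic_germ C Y" "Im w = 0" "Im \<beta> = 0"
    and real: "\<And>z. z \<in> quadratic_germ C Y \<Longrightarrow> Im z = 0 \<Longrightarrow> Im (f z) = 0"
  shows "Im (correction w) = 0"
proof -
  have "w \<in> quadratic_germ C X" using assms(1,2) quadratic_germ_mono by blast
  note sum = summable_displacement[OF this]
  have orb: "Im ((f ^^ n) w) = 0" for n
    using orbit[OF assms(1,2)] by (induction n) (auto simp: assms(3) real)
  have "Im (f ((f ^^ n) w) - (f ^^ n) w - \<beta>) = 0" for n
    using orb[of n] orb[of "Suc n"] assms(4) by simp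
  then show ?thesis
    unfolding correction_def bounded_linear.suminf[OF bounded_linear_Im sum] by simp
qed

end

section \<open>Periodic germs tangent to the identity\<close>

text \<open>If \<open>h\<close> is small, then it is nearly constant along short orbits of \<open>\<phi> = id + h\<close> by Cauchy's
  estimate, so that the displacement of the \<open>q\<close>-th iterate is about \<open>q * h\<close>. Hence \<open>h\<close> vanishes on
  the positive real axis far out, and by the identity theorem everywhere.\<close>

lemma periodic_tangent_to_id:
  fixes h :: "complex \<Rightarrow> complex"
  assumes C: "C > 0" and h: "h holomorphic_on {w \<in> quadratic_domain C. X < Re w}"
    and lim: "(h \<longlongrightarrow> 0) (Re_at_top_in C)"
    and per: "iterate_eq_id_germ C q (\<lambda>\<zeta>. \<zeta> + h \<zeta>)" and q: "q \<ge> 1"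
    and w: "w \<in> quadratic_domain C" "X < Re w"
  shows "h w = 0"
proof -
  let ?D = "{w \<in> quadratic_domain C. X < Re w}"
  define \<phi> where "\<phi> \<zeta> = \<zeta> + h \<zeta>" for \<zeta>
  obtain R where R: "\<And>\<zeta>. (\<And>k. k < q \<Longrightarrow> (\<phi> ^^ k) \<zeta> \<in> quadratic_germ C R) \<Longrightarrow> (\<phi> ^^ q) \<zeta> = \<zeta>"
    using per unfolding iterate_eq_id_germ_def \<phi>_def[abs_def] by blast
  \<comment> \<open>So small that the deviations of \<open>h\<close> along an orbit of length \<open>q\<close> add up to at most \<open>norm h / 2\<close>\<close>
  define e where "e = 1 / (4 * real q ^ 2)"
  have e: "e > 0" using q by (simp add: e_def)
  have "real q \<le> real q ^ 2" using q by (intro self_le_power) auto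
  then have qe: "2 * real q * e \<le> 1 / 2" "2 * (real q)\<^sup>2 * e = 1 / 2"
    using q by (auto simp: e_def field_simps)
  have "\<forall>\<^sub>F \<zeta> in Re_at_top_in C. norm (h \<zeta>) < e" using tendstoD[OF lim e] by simp
  then obtain Y where Y: "\<And>\<zeta>. \<zeta> \<in> quadratic_domain C \<Longrightarrow> Y \<le> Re \<zeta> \<Longrightarrow> norm (h \<zeta>) < e"
    by (auto simp: eventually_Re_at_top_in)
  define Z where "Z = max (max Y X) (max R (3 * C))"
  have wide: "z \<in> ?D \<and> norm (h z) < e \<and> z \<in> quadratic_germ C R"
    if "Re z > Z" "\<bar>Im z\<bar> \<le> 2" for z
  proof -
    have "C * (1 + \<bar>Im z\<bar>) \<le> C * 3" using C that by (intro mult_left_mono) auto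
    then have "z \<in> quadratic_domain C"
      using that by (intro half_strip_subset_quadratic_domain[OF C]) (auto simp: Z_def)
    then show ?thesis using Y[of z] that by (auto simp: Z_def quadratic_germ_def)
  qed
  \<comment> \<open>A narrower convex half-strip, so that the discs of radius 1 for Cauchy's estimate stay in the wide one\<close>
  define A where "A = {z. Z + 1 < Re z} \<inter> {z. \<bar>Im z\<bar> < 1}"
  have open_D: "open ?D"
  proof -
    have "?D = quadratic_domain C \<inter> {w. X < Re w}" by auto
    then show ?thesis using open_quadratic_domain[OF C] by (simp add: open_Int open_halfspace_Re_gt)
  qed
  have A_D: "A \<subseteq> ?D" using wide by (force simp: A_def)
  have convex: "convex A"
  proof -
    have "A = {z. Z + 1 < Re z} \<inter> ({z. Im z < 1} \<inter> {z. - 1 < Im z})" by (auto simp: A_def)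
    then show ?thesis
      using convex_halfspace_Re_gt convex_halfspace_Im_lt convex_halfspace_Im_gt
      by (metis convex_Int)
  qed
  have deriv: "norm (deriv h z) \<le> e" if z: "z \<in> A" for z
  proof -
    have near: "Z < Re x \<and> \<bar>Im x\<bar> \<le> 2" if "dist z x \<le> 1" for x
      using z that abs_Re_le_cmod[of "z - x"] abs_Im_le_cmod[of "z - x"]
      by (auto simp: A_def dist_norm)
    then have sub: "cball z 1 \<subseteq> ?D" using wide by auto
    have "norm ((deriv ^^ 1) h z) \<le> fact 1 * e / 1 ^ 1"
    proof (rule Cauchy_inequality)
      show "h holomorphic_on ball z 1"
        by (rule holomorphic_on_subset[OF h]) (use sub ball_subset_cball in blast)
      show "continuous_on (cball z 1) h"
        by (rule holomorphic_on_imp_continuous_on, rule holomorphic_on_subset[OF h sub])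
      show "norm (h x) \<le> e" if "norm (z - x) = 1" for x
        using wide[of x] near[of x] that by (auto simp: dist_norm)
    qed simp
    then show ?thesis by simp
  qed
  have lip: "norm (h x - h y) \<le> e * norm (x - y)" if "x \<in> A" "y \<in> A" for x y
  proof (rule field_differentiable_bound[OF convex _ deriv that])
    show "(h has_field_derivative deriv h z) (at z within A)" if "z \<in> A" for z
      using holomorphic_derivI[OF h open_D] A_D that by blast
  qed
  have zero: "h (of_real x) = 0" if x: "x > Z + 3" for x
  proof -
    define z where "z k = (\<phi> ^^ k) (complex_of_real x)" for k
    define d where "d = norm (h (of_real x))"
    have z_Suc: "z (Suc k) = z k + h (z k)" for k by (simp add: z_def \<phi>_def)
    have d: "0 \<le> d" "d < e" using wide[of "of_real x"] x by (auto simp: d_def)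
    have xA: "of_real x \<in> A" using x by (simp add: A_def)
    have near: "y \<in> A \<and> norm (y - of_real x) \<le> 2 * real q * d"
      if y: "norm (y - of_real x - of_nat k * h (of_real x)) \<le> real k * (1 / 2 * d)" and k: "k \<le> q" for y k
    proof -
      have "norm (y - of_real x) \<le> real k * (1 / 2 * d) + real k * d"
        using y norm_triangle_ineq[of "y - of_real x - of_nat k * h (of_real x)" "of_nat k * h (of_real x)"]
        by (simp add: d_def norm_mult)
      also have "\<dots> \<le> real q * (1 / 2 * d) + real q * d"
        using d k by (intro add_mono mult_right_mono) auto
      also have "\<dots> \<le> 2 * real q * d" using d by simp
      finally have le: "norm (y - of_real x) \<le> 2 * real q * d" .
      also have "\<dots> \<le> 2 * real q * e" using d by (intro mult_left_mono) auto
      finally have "norm (y - of_real x) \<le> 1 / 2" using qe by linarith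
      then have "y \<in> A"
        using x abs_Re_le_cmod[of "y - of_real x"] abs_Im_le_cmod[of "y - of_real x"]
        by (auto simp: A_def)
      with le show ?thesis by blast
    qed
    have orb: "norm (z k - of_real x - of_nat k * h (of_real x)) \<le> real k * (2 * real q * e * d)"
      if "k \<le> q" for k
      using that
    proof (induction k)
      case 0
      then show ?case by (simp add: z_def)
    next
      case (Suc k)
      have "real k * (2 * real q * e * d) \<le> real k * (1 / 2 * d)"
        using qe d by (intro mult_left_mono mult_right_mono) auto
      then have zA: "z k \<in> A" "norm (z k - of_real x) \<le> 2 * real q * d"
        using near[of "z k" k] Suc by auto
      have "norm (h (z k) - h (of_real x)) \<le> e * norm (z k - of_real x)" by (rule lip[OF zA(1) xA])
      also have "\<dots> \<le> e * (2 * real q * d)" using zA(2) e by (intro mult_left_mono) auto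
      finally have step: "norm (h (z k) - h (of_real x)) \<le> 2 * real q * e * d" by (simp add: mult_ac)
      have "z (Suc k) - of_real x - of_nat (Suc k) * h (of_real x) =
          (z k - of_real x - of_nat k * h (of_real x)) + (h (z k) - h (of_real x))"
        by (simp add: z_Suc algebra_simps)
      also have "norm \<dots> \<le> real k * (2 * real q * e * d) + 2 * real q * e * d"
        using Suc step by (intro norm_triangle_mono) auto
      finally show ?case by (simp add: algebra_simps)
    qed
    have inA: "z k \<in> A" if "k \<le> q" for k
    proof -
      have "real k * (2 * real q * e * d) \<le> real k * (1 / 2 * d)"
        using qe d by (intro mult_left_mono mult_right_mono) auto
      then show ?thesis using near[of "z k" k] orb[OF that] that by auto
    qed
    have "(\<phi> ^^ q) (of_real x) = of_real x"
    proof (rule R)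
      fix k assume "k < q"
      then have "z k \<in> A" by (intro inA) simp
      then show "(\<phi> ^^ k) (of_real x) \<in> quadratic_germ C R"
        using wide[of "z k"] by (auto simp: z_def A_def)
    qed
    then have "real q * d \<le> real q * (2 * real q * e * d)"
      using orb[of q] by (simp add: z_def norm_mult d_def)
    also have "\<dots> = (2 * (real q)\<^sup>2 * e) * d" by (simp add: power2_eq_square)
    finally have "real q * d \<le> 1 / 2 * d" unfolding qe .
    moreover have "1 * d \<le> real q * d" using q d by (intro mult_right_mono) auto
    ultimately have "d = 0" using d by simp
    then show ?thesis by (simp add: d_def)
  qed
  show ?thesis
  proof (rule analytic_continuation[OF h open_D connected_quadratic_domain_right[OF C]])
    show "complex_of_real ` {Z + 3<..} \<subseteq> ?D"
    proof (rule image_subsetI)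
      fix x assume "x \<in> {Z + 3<..}"
      then show "of_real x \<in> ?D"
        using wide[of "of_real x"] by auto
    qed
    show "complex_of_real (Z + 4) \<in> ?D" using wide[of "of_real (Z + 4)"] by auto
    show "complex_of_real (Z + 4) islimpt complex_of_real ` {Z + 3<..}"
      unfolding islimpt_approachable
    proof (intro allI impI)
      fix r :: real assume r: "r > 0"
      have "dist (complex_of_real (Z + 4 + r / 2)) (of_real (Z + 4)) < r"
        unfolding dist_of_real using r by (simp add: dist_real_def)
      then show "\<exists>y\<in>complex_of_real ` {Z + 3<..}. y \<noteq> of_real (Z + 4) \<and> dist y (of_real (Z + 4)) < r"
        using r by (intro bexI[of _ "complex_of_real (Z + 4 + r / 2)"]) (auto simp: complex_eq_iff)
    qed
  qed (use zero w in auto)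
qed

section \<open>Hyperbolic Dulac germs\<close>

lemma dulac_expansion_imp_has_exp_expansion:
  assumes "dulac_expansion C f \<alpha> \<beta> P a" "range a \<subseteq> S"
  shows "has_exp_expansion C S (\<lambda>\<zeta>. f \<zeta> - of_real \<alpha> * \<zeta> - \<beta>)"
  unfolding has_exp_expansion_def
proof
  fix \<nu> :: real
  obtain N where N: "(\<lambda>\<zeta>. f \<zeta> - of_real \<alpha> * \<zeta> - \<beta> - exp_partial_sum a P N \<zeta>)
      \<in> o[Re_at_top_in C](decay (max \<nu> 1))"
    using assms(1)[unfolded dulac_expansion_def, rule_format, of "max \<nu> 1", OF max.strict_coboundedI2]
    unfolding exp_partial_sum_def by (meson zero_less_one)
  have "expsum S (exp_partial_sum a P N)"
    using assms(2) by (intro expsum_exp_partial_sum) auto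
  moreover have "(\<lambda>\<zeta>. f \<zeta> - of_real \<alpha> * \<zeta> - \<beta> - exp_partial_sum a P N \<zeta>) \<in> O[Re_at_top_in C](decay \<nu>)"
    by (rule bigo_decay_mono[OF landau_o.small_imp_big[OF N]]) simp
  ultimately show "\<exists>k. expsum S k \<and>
      (\<lambda>\<zeta>. f \<zeta> - of_real \<alpha> * \<zeta> - \<beta> - k \<zeta>) \<in> O[Re_at_top_in C](decay \<nu>)"
    by blast
qed

lemma hyperbolic_imp_attracting_map:
  assumes C: "C > 0" and R: "f holomorphic_on quadratic_germ C R" and \<beta>: "Re \<beta> > 0"
    and \<epsilon>: "\<epsilon> > 0" and g: "(\<lambda>\<zeta>. f \<zeta> - \<zeta> - \<beta>) \<in> O[Re_at_top_in C](decay \<epsilon>)"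
  shows "\<exists>X M. R \<le> X \<and> attracting_map C X (Re \<beta> / 2) \<epsilon> M \<beta> f"
proof -
  obtain M where M: "M > 0" "\<forall>\<^sub>F \<zeta> in Re_at_top_in C. norm (f \<zeta> - \<zeta> - \<beta>) \<le> M * norm (decay \<epsilon> \<zeta>)"
    using g by (rule landau_o.bigE)
  have "\<forall>\<^sub>F \<zeta> in Re_at_top_in C. norm (f \<zeta> - \<zeta> - \<beta>) < Re \<beta> / 2"
    using tendstoD[OF bigo_decay_tendsto_0[OF g \<epsilon>], of "Re \<beta> / 2"] \<beta> by simp
  with M(2) have "\<forall>\<^sub>F \<zeta> in Re_at_top_in C.
      norm (f \<zeta> - \<zeta> - \<beta>) \<le> M * norm (decay \<epsilon> \<zeta>) \<and> norm (f \<zeta> - \<zeta> - \<beta>) < Re \<beta> / 2"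
    by eventually_elim simp
  then obtain Y where Y: "\<And>\<zeta>. \<zeta> \<in> quadratic_domain C \<Longrightarrow> Y \<le> Re \<zeta> \<Longrightarrow>
      norm (f \<zeta> - \<zeta> - \<beta>) \<le> M * exp (- \<epsilon> * Re \<zeta>) \<and> norm (f \<zeta> - \<zeta> - \<beta>) < Re \<beta> / 2"
    by (auto simp: eventually_Re_at_top_in norm_exp)
  \<comment> \<open>Beyond real part \<open>B\<close> the domain is steep enough for translations by vectors near \<open>\<beta>\<close>.\<close>
  define B where "B = (norm \<beta> + Re \<beta> / 2) * C\<^sup>2 / (2 * Re \<beta>)"
  define X where "X = max R (max Y B)"
  have "attracting_map C X (Re \<beta> / 2) \<epsilon> M \<beta> f"
  proof
    show "f holomorphic_on quadratic_germ C X"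
      by (rule holomorphic_on_subset[OF R quadratic_germ_mono]) (simp add: X_def)
  next
    fix w assume w: "w \<in> quadratic_germ C X"
    then have w': "w \<in> quadratic_domain C" "Y \<le> Re w" "B \<le> Re w"
      by (auto simp: quadratic_germ_def X_def)
    define b where "b = f w - w"
    have b: "norm (b - \<beta>) < Re \<beta> / 2" "f w = w + b" using Y[OF w'(1,2)] by (auto simp: b_def)
    have Re_b: "Re \<beta> / 2 < Re b"
      using abs_Re_le_cmod[of "b - \<beta>"] b(1) by (simp add: abs_le_iff)
    show "Re w + Re \<beta> / 2 \<le> Re (f w)" using Re_b b(2) by simp
    show "norm (f w - w - \<beta>) \<le> M * exp (- \<epsilon> * Re w)" using Y[OF w'(1,2)] by blast
    have "norm b * C\<^sup>2 \<le> (norm \<beta> + Re \<beta> / 2) * C\<^sup>2"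
      using norm_triangle_sub[of b \<beta>] b(1) by (intro mult_right_mono) auto
    also have "\<dots> = B * (2 * Re \<beta>)" using \<beta> by (simp add: B_def)
    also have "\<dots> \<le> Re w * (2 * Re \<beta>)" using w'(3) \<beta> by (intro mult_right_mono) auto
    also have "\<dots> \<le> Re w * (4 * Re b)"
      using Re_b quadratic_domain_Re_pos[OF C w'(1)] by (intro mult_left_mono) auto
    finally have "norm b * C\<^sup>2 \<le> 4 * Re w * Re b" by (simp add: mult_ac)
    then show "f w \<in> quadratic_domain C"
      unfolding b(2) using Re_b \<beta> by (intro quadratic_domain_translate[OF C w'(1)]) auto
  qed (use C \<beta> \<epsilon> M in auto)
  moreover have "R \<le> X" by (simp add: X_def)
  ultimately show ?thesis by blast
qed

theorem theoremB:
  fixes C :: real and \<beta> :: complex and f :: "complex \<Rightarrow> complex"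
  assumes "C > 0"
    and "complex_dulac_germ C f"
    and "hyperbolic_germ C \<beta> f"
  shows "\<exists>\<phi>.
     tangent_to_id_germ C \<phi> \<and> abel_equation_germ C \<beta> f \<phi> \<and>
     (\<not> germ_eq C f (\<lambda>\<zeta>. \<zeta> + \<beta>) \<longrightarrow> parabolic_germ C \<phi>) \<and>
     (\<forall>\<psi>. tangent_to_id_germ C \<psi> \<and> abel_equation_germ C \<beta> f \<psi> \<longrightarrow> germ_eq C \<psi> \<phi>) \<and>
     (\<exists>C'>0. quadratic_domain C' \<subseteq> quadratic_domain C \<and>
        parabolic_complex_dulac_germ C' \<phi> \<and>
        (real_dulac_germ C f \<longrightarrow> real_dulac_germ C' \<phi>))"
proof -
  obtain \<alpha> \<beta>' P a where a: "dulac_exponents a" and expansion: "dulac_expansion C f \<alpha> \<beta>' P a"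
    using assms(2) unfolding complex_dulac_germ_def by blast
  from a obtain G where G: "finite G" "G \<subseteq> {0<..}" "range a \<subseteq> subsemigroup_gen G" and "strict_mono a"
    unfolding dulac_exponents_def by blast
  define S where "S = subsemigroup_gen G"
  \<comment> \<open>Inserting 1 avoids the empty minimum.\<close>
  define \<delta> where "\<delta> = Min (insert 1 G)"
  have \<delta>: "\<delta> > 0" "\<And>g. g \<in> G \<Longrightarrow> \<delta> \<le> g"
    using G(1,2) by (auto simp: \<delta>_def)
  have S_ge: "\<delta> \<le> s" if "s \<in> S" for s
    using subsemigroup_gen_ge[of s G \<delta>] that \<delta> by (simp add: S_def)
  interpret exponent_semigroup C S \<delta>
    by standard (use assms(1) \<delta>(1) S_ge in \<open>auto simp: S_def intro: subsemigroup_gen.add\<close>)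
  have \<beta>: "Re \<beta> > 0" and hyp: "((\<lambda>\<zeta>. f \<zeta> - (\<zeta> + \<beta>)) \<longlongrightarrow> 0) (Re_at_top_in C)"
    using assms(3) by (auto simp: hyperbolic_germ_def at_infinity_in_eq[OF assms(1)])

  \<comment> \<open>The leading coefficients of the series are forced by the two descriptions of \<open>f\<close>.\<close>
  have f_exp: "has_exp_expansion C S (\<lambda>\<zeta>. f \<zeta> - of_real \<alpha> * \<zeta> - \<beta>')"
    by (rule dulac_expansion_imp_has_exp_expansion[OF expansion]) (use G in \<open>simp add: S_def\<close>)
  then have "((\<lambda>\<zeta>. f \<zeta> - of_real \<alpha> * \<zeta> - \<beta>') \<longlongrightarrow> 0) (Re_at_top_in C)"
    using \<delta>(1) by (intro bigo_decay_tendsto_0[OF expansion_bigo, of _ "\<delta> / 2"]) auto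
  from tendsto_diff[OF this hyp]
  have "((\<lambda>\<zeta>. (f \<zeta> - of_real \<alpha> * \<zeta> - \<beta>') - (f \<zeta> - (\<zeta> + \<beta>))) \<longlongrightarrow> 0) (Re_at_top_in C)" by simp
  moreover have "(\<lambda>\<zeta>. (f \<zeta> - of_real \<alpha> * \<zeta> - \<beta>') - (f \<zeta> - (\<zeta> + \<beta>))) =
      poly [:\<beta> - \<beta>', 1 - of_real \<alpha>:]"
    by (simp add: fun_eq_iff algebra_simps)
  ultimately have "[:\<beta> - \<beta>', 1 - of_real \<alpha>:] = 0"
    by (intro poly_tendsto_0_imp_0[OF assms(1)]) simp
  then have "has_exp_expansion C S (\<lambda>\<zeta>. f \<zeta> - \<zeta> - \<beta>)" using f_exp by simp
  note g_exp = this
  obtain R where R: "R > 0" "f holomorphic_on quadratic_germ C R"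
    using assms(3) by (auto simp: hyperbolic_germ_def holomorphic_germ_def)
  obtain X M where "R \<le> X" and attr: "attracting_map C X (Re \<beta> / 2) (\<delta> / 2) M \<beta> f"
    using hyperbolic_imp_attracting_map[OF assms(1) R(2) \<beta> _ expansion_bigo[OF g_exp, of "\<delta> / 2"]] \<delta>(1)
    by auto
  interpret attracting_map C X "Re \<beta> / 2" "\<delta> / 2" M \<beta> f by (rule attr)
  define \<phi> where "\<phi> \<zeta> = \<zeta> + correction \<zeta>" for \<zeta>
  define Y where "Y = X + 1"
  have Y: "Y > 0" "X \<le> Y" using R(1) \<open>R \<le> X\<close> by (auto simp: Y_def)
  have germ_region: "quadratic_germ C Y \<subseteq> region"
    by (auto simp: Y_def quadratic_germ_def region_def)
  have germ_X: "quadratic_germ C Y \<subseteq> quadratic_germ C X" by (rule quadratic_germ_mono[OF Y(2)])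
  have hol: "\<phi> holomorphic_on quadratic_germ C Y"
    unfolding \<phi>_def[abs_def]
    by (intro holomorphic_intros holomorphic_on_subset[OF holomorphic_correction germ_region])
  have abel: "\<phi> (f w) = \<phi> w + \<beta>" if "w \<in> quadratic_germ C X" for w
    using correction_comp[OF that] by (simp add: \<phi>_def)

  have tangent: "tangent_to_id_germ C \<phi>"
    unfolding tangent_to_id_germ_def holomorphic_germ_def at_infinity_in_eq[OF assms(1)]
    using hol Y(1) correction_tendsto_0 by (auto simp: \<phi>_def)

  have abel_germ: "abel_equation_germ C \<beta> f \<phi>"
    unfolding abel_equation_germ_def
    using Y(1) holomorphic_on_subset[OF holomorphic germ_X] hol invariant[OF Y(2)] abel germ_X
    by (intro exI[of _ Y]) blast

  have parabolic: "parabolic_germ C \<phi>" if not_translation: "\<not> germ_eq C f (\<lambda>\<zeta>. \<zeta> + \<beta>)"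
    unfolding parabolic_germ_def
  proof (intro conjI tangent allI impI notI)
    fix q :: nat assume q: "1 \<le> q" "iterate_eq_id_germ C q \<phi>"
    have zero: "correction w = 0" if "w \<in> quadratic_germ C Y" for w
      using periodic_tangent_to_id[OF assms(1) holomorphic_correction[unfolded region_def]
          correction_tendsto_0 _ q(1), of w] q(2) that germ_region
      by (auto simp: \<phi>_def[abs_def] region_def)
    have "f w = w + \<beta>" if w: "w \<in> quadratic_germ C Y" for w
      using abel[of w] zero[OF w] zero[OF invariant[OF Y(2) w]] w germ_X by (auto simp: \<phi>_def)
    then show False using not_translation Y(1) unfolding germ_eq_def by blast
  qed

  have unique: "germ_eq C \<psi> \<phi>" if \<psi>: "tangent_to_id_germ C \<psi>" "abel_equation_germ C \<beta> f \<psi>" for \<psi>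
  proof -
    obtain R' where R': "\<And>w. w \<in> quadratic_germ C R' \<Longrightarrow> \<psi> (f w) = \<psi> w + \<beta>"
      using \<psi>(2) unfolding abel_equation_germ_def by blast
    define Z where "Z = max Y R'"
    have Z: "X \<le> Z" "Z > 0" using Y by (auto simp: Z_def)
    have "((\<lambda>\<zeta>. \<psi> \<zeta> - \<zeta> - correction \<zeta>) \<longlongrightarrow> 0 - 0) (Re_at_top_in C)"
      using \<psi>(1) correction_tendsto_0
      by (intro tendsto_diff[of _ 0]) (auto simp: tangent_to_id_germ_def at_infinity_in_eq[OF assms(1)])
    then have lim: "((\<lambda>\<zeta>. \<psi> \<zeta> - \<phi> \<zeta>) \<longlongrightarrow> 0) (Re_at_top_in C)"
      by (simp add: \<phi>_def algebra_simps)
    have "\<psi> w - \<phi> w = 0" if w: "w \<in> quadratic_germ C Z" for w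
    proof (rule invariant_function_eq_0[OF Z(1) w lim])
      fix z assume "z \<in> quadratic_germ C Z"
      then have "z \<in> quadratic_germ C X" "z \<in> quadratic_germ C R'"
        using Y(2) by (auto simp: quadratic_germ_def Z_def)
      then show "\<psi> (f z) - \<phi> (f z) = \<psi> z - \<phi> z" by (simp add: R' abel)
    qed
    then show ?thesis unfolding germ_eq_def using Z(2) by auto
  qed

  have "infinite S"
    using G(3) \<open>strict_mono a\<close> range_inj_infinite[of a] infinite_super[of "range a" S]
    by (auto simp: S_def strict_mono_imp_inj_on)
  then obtain b where b: "strict_mono b" "range b = S" "filterlim b at_top sequentially"
    using locally_finite_enumeration[of S] finite_subsemigroup_gen_below[OF G(1) \<delta>(2,1)]
    unfolding S_def by blast
  have b_exponents: "dulac_exponents b"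
    unfolding dulac_exponents_def
  proof (intro conjI b allI exI[of _ G] G)
    show "0 < b i" for i using S_ge[of "b i"] b(2) \<delta>(1) by auto
  qed (simp add: b(2) S_def)
  have "has_exp_expansion C (range b) correction"
    unfolding b(2) using correction_has_exp_expansion[OF exponent_semigroup_axioms g_exp \<beta>] .
  from has_exp_expansion_imp_series[OF assms(1) b(1,3) this]
  obtain Q where Q: "\<And>\<nu>. \<exists>N. (\<lambda>\<zeta>. correction \<zeta> - exp_partial_sum b Q N \<zeta>) \<in> o[Re_at_top_in C](decay \<nu>)"
    by blast
  have "dulac_expansion C \<phi> 1 0 Q b"
    unfolding dulac_expansion_def using Q by (simp add: \<phi>_def exp_partial_sum_def)
  then have dulac: "parabolic_complex_dulac_germ C \<phi>"
    unfolding parabolic_complex_dulac_germ_def holomorphic_germ_def using hol Y(1) b_exponents by blast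

  have real: "real_dulac_germ C \<phi>" if f_real: "real_dulac_germ C f"
  proof -
    obtain R' where R': "f ` {\<zeta> \<in> quadratic_germ C R'. Im \<zeta> = 0} \<subseteq> {\<zeta> \<in> quadratic_domain C. Im \<zeta> = 0}"
      using f_real unfolding real_dulac_germ_def by blast
    have f_real: "Im (f z) = 0" if "z \<in> quadratic_germ C R'" "Im z = 0" for z
      using R' that by blast
    have lim: "((\<lambda>x. Im (f (of_real x) - (of_real x + \<beta>))) \<longlongrightarrow> Im 0) at_top"
      by (rule tendsto_Im[OF filterlim_compose[OF hyp filterlim_of_real_Re_at_top_in[OF assms(1)]]])
    have ev: "\<forall>\<^sub>F x in at_top. Im (f (of_real x) - (of_real x + \<beta>)) = - Im \<beta>"
      using eventually_gt_at_top[of "max C R'"]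
    proof eventually_elim
      case (elim x)
      then have "complex_of_real x \<in> quadratic_germ C R'"
        using half_strip_subset_quadratic_domain[OF assms(1), of "of_real x"]
        by (auto simp: quadratic_germ_def)
      then show ?case using f_real by simp
    qed
    from Lim_transform_eventually[OF lim ev] have \<beta>_real: "Im \<beta> = 0" by (simp add: tendsto_const_iff)
    have "\<forall>\<^sub>F \<zeta> in Re_at_top_in C. norm (correction \<zeta>) < 1"
      using tendstoD[OF correction_tendsto_0, of 1] by simp
    then obtain W where W: "\<And>\<zeta>. \<zeta> \<in> quadratic_domain C \<Longrightarrow> W \<le> Re \<zeta> \<Longrightarrow> norm (correction \<zeta>) < 1"
      by (auto simp: eventually_Re_at_top_in)
    define Z where "Z = max (max Y R') (max W (C + 1))"
    have "\<phi> w \<in> quadratic_domain C \<and> Im (\<phi> w) = 0" if w: "w \<in> quadratic_germ C Z" "Im w = 0" for w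
    proof -
      have "Im (correction w) = 0"
      proof (rule correction_real[OF _ w \<beta>_real])
        show "X \<le> Z" using Y(2) by (simp add: Z_def)
        fix z assume "z \<in> quadratic_germ C Z" "Im z = 0"
        then show "Im (f z) = 0"
          by (intro f_real) (auto simp: quadratic_germ_def Z_def)
      qed
      then have Im: "Im (\<phi> w) = 0" using w(2) by (simp add: \<phi>_def)
      have "norm (correction w) < 1" "Re w \<ge> C + 1"
        using w W[of w] by (auto simp: quadratic_germ_def Z_def)
      then have "C < Re (\<phi> w)"
        using abs_Re_le_cmod[of "correction w"] by (simp add: \<phi>_def)
      then show ?thesis using Im half_strip_subset_quadratic_domain[OF assms(1), of "\<phi> w"] by simp
    qed
    moreover have "Z > 0" using Y(1) by (simp add: Z_def)
    moreover have "complex_dulac_germ C \<phi>"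
      using dulac zero_less_one unfolding complex_dulac_germ_def parabolic_complex_dulac_germ_def by metis
    ultimately show ?thesis unfolding real_dulac_germ_def by blast
  qed

  show ?thesis
    using tangent abel_germ parabolic unique dulac real assms(1)
    by (intro exI[of _ \<phi>] conjI allI impI exI[of _ C]) auto
qed

end
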